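(* Let $K$ be an infinite field of characteristic different from $2$ and $3$, let $(A,\omega)$ be a Bernstein algebra over $K$ which is Noetherian or Artinian, with Peirce decomposition $A=Ke\oplus U\oplus V$ relative to a nonzero idempotent $e$, and let $N=U\oplus V$ be its barideal. Let $I$ be a subspace of $A$. (i) If $NI=I$, then $I\subseteq \mathrm{ann}_U(U)$ and $I$ is an ideal of $A$. (ii) $NI=I$ if and only if $VI=I$.
   Context: Algebras over $K$ are not assumed associative, unital or finite-dimensional. A baric algebra over $K$ is a pair $(A,\omega)$ where $A$ is a $K$-algebra and $\omega:A\to K$ is a nonzero homomorphism of $K$-algebras; its barideal is $N=\ker(\omega)$. A Bernstein algebra is a commutative baric algebra $(A,\omega)$ satisfying $(x^2)^2=\omega(x)^2x^2$ for all $x\in A$. Such an algebra has a nonzero idempotent $e$ (with $\omega(e)=1$), and then $A=Ke\oplus U\oplus V$ (Peirce decomposition), where $U=\{u\in A: eu=\tfrac12 u\}$, $V=\{v\in A: ev=0\}$ and $N=U\oplus V$. Moreover, $\mathrm{ann}_U(U)=\{u\in U: uU=0\}$. For subspaces $X,Y$ of $A$, $XY$ denotes the linear span of the products $xy$ with $x\in X$, $y\in Y$. An algebra is Noetherian (Artinian) if every ascending (descending) sequence of its ideals is stationary. *)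

theory Defs
  imports "HOL-Computational_Algebra.Computational_Algebra"
begin

text \<open>
  An algebra over the field \<open>'k\<close> is the whole type \<open>'a\<close> with a scalar multiplication
  and a bilinear product; no associativity, unit or finite-dimensionality is required.
\<close>

locale nonassoc_algebra = vector_space scale
  for scale :: "'k::field \<Rightarrow> 'a::ab_group_add \<Rightarrow> 'a" (infixr "*s" 75) +
  fixes mul :: "'a \<Rightarrow> 'a \<Rightarrow> 'a" (infixl "\<odot>" 70)
  assumes mul_add_left: "(x + y) \<odot> z = x \<odot> z + y \<odot> z"
    and mul_add_right: "x \<odot> (y + z) = x \<odot> y + x \<odot> z"
    and mul_scale_left: "(c *s x) \<odot> y = c *s (x \<odot> y)"
    and mul_scale_right: "x \<odot> (c *s y) = c *s (x \<odot> y)"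
begin

definition subspace_prod :: "'a set \<Rightarrow> 'a set \<Rightarrow> 'a set"
  where "subspace_prod X Y = span {x \<odot> y | x y. x \<in> X \<and> y \<in> Y}"

definition ideal :: "'a set \<Rightarrow> bool"
  where "ideal J \<longleftrightarrow> subspace J \<and> (\<forall>a. \<forall>x\<in>J. a \<odot> x \<in> J \<and> x \<odot> a \<in> J)"

definition noetherian :: bool
  where "noetherian \<longleftrightarrow>
    (\<forall>J :: nat \<Rightarrow> 'a set. (\<forall>n. ideal (J n)) \<and> (\<forall>n. J n \<subseteq> J (Suc n))
       \<longrightarrow> (\<exists>m. \<forall>n\<ge>m. J n = J m))"

definition artinian :: bool
  where "artinian \<longleftrightarrow>
    (\<forall>J :: nat \<Rightarrow> 'a set. (\<forall>n. ideal (J n)) \<and> (\<forall>n. J (Suc n) \<subseteq> J n)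
       \<longrightarrow> (\<exists>m. \<forall>n\<ge>m. J n = J m))"

definition annihilator :: "'a set \<Rightarrow> 'a set \<Rightarrow> 'a set"
  where "annihilator X Y = {x \<in> X. \<forall>y\<in>Y. x \<odot> y = 0}"

definition peirce_U :: "'a \<Rightarrow> 'a set"
  where "peirce_U e = {u. e \<odot> u = (1 / 2) *s u}"

definition peirce_V :: "'a \<Rightarrow> 'a set"
  where "peirce_V e = {v. e \<odot> v = 0}"

end

locale baric_algebra = nonassoc_algebra scale mul
  for scale :: "'k::field \<Rightarrow> 'a::ab_group_add \<Rightarrow> 'a" (infixr "*s" 75)
    and mul :: "'a \<Rightarrow> 'a \<Rightarrow> 'a" (infixl "\<odot>" 70) +
  fixes \<omega> :: "'a \<Rightarrow> 'k"
  assumes weight_linear: "Vector_Spaces.linear scale (*) \<omega>"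
    and weight_mult: "\<omega> (x \<odot> y) = \<omega> x * \<omega> y"
    and weight_nonzero: "\<exists>x. \<omega> x \<noteq> 0"
begin

definition barideal :: "'a set"
  where "barideal = {x. \<omega> x = 0}"

end

locale bernstein_algebra = baric_algebra scale mul \<omega>
  for scale :: "'k::field \<Rightarrow> 'a::ab_group_add \<Rightarrow> 'a" (infixr "*s" 75)
    and mul :: "'a \<Rightarrow> 'a \<Rightarrow> 'a" (infixl "\<odot>" 70)
    and \<omega> :: "'a \<Rightarrow> 'k" +
  assumes mul_commute: "x \<odot> y = y \<odot> x"
    and bernstein: "(x \<odot> x) \<odot> (x \<odot> x) = (\<omega> x)\<^sup>2 *s (x \<odot> x)"

end

theory Submission
  imports Defs
begin

text \<open>
  Let \<open>L\<close> be the annihilator of \<open>U\<close> in \<open>U\<close>.  The statement reduces to one fact: a subspace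
  \<open>I \<subseteq> N\<close> with \<open>I \<subseteq> N I\<close> lies in \<open>L\<close>.  Indeed \<open>N I = I\<close> and \<open>V I = I\<close> both imply this inclusion,
  and once \<open>U I = 0\<close> the products \<open>N I\<close> and \<open>V I\<close> coincide; moreover \<open>e\<close> acts on \<open>L\<close> as the scalar
  one half, so \<open>N I = I\<close> makes \<open>I\<close> an ideal.  The fact follows if some power \<open>N (N ( ... N))\<close> is contained
  in \<open>L\<close>, that is, if \<open>N\<close> modulo \<open>L\<close> is nilpotent.

  Expanding the Bernstein identity at \<open>e + n\<close> gives the Peirce relations (\<open>bernstein_components\<close>
  and its consequences).  They show that \<open>L\<close> is an ideal and that \<open>N\<close> modulo \<open>L\<close> is a mock-Lie
  algebra: it is commutative and satisfies the Jacobi identity.  It is graded with odd part \<open>U\<close> and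
  even part \<open>V\<close>, and its even part has zero product.

  Nilpotency has two ingredients.  Such a graded algebra is solvable
  (\<open>derived_eventually_zero\<close>): the heart is the identity
  \<open>w (v ((a a') ((b d) c))) = 0\<close> for \<open>v, w\<close> in \<open>V\<close> and \<open>a, a', b, d, c\<close> in \<open>U\<close> (\<open>VVWW_zero\<close>).
  Secondly, a solvable mock-Lie algebra \<open>N\<close> that is finite-dimensional modulo \<open>N N\<close> is nilpotent:
  a finite-dimensional quotient \<open>N / D\<close> acts nilpotently on \<open>D\<close> modulo \<open>D D\<close>, because multiplication
  operators anticommute up to shorter terms (\<open>square_of_extension\<close>); hence every term of the derived
  series contains a power of \<open>N\<close> (\<open>lower_central_below_derived\<close>).

  The chain condition enters only through the dimension of \<open>N / N N\<close>: subspaces between \<open>N N\<close> and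
  \<open>N\<close> that are spanned by \<open>N N\<close> and elements of \<open>U\<close> and \<open>V\<close> are ideals of \<open>A\<close>, so an infinite
  dimension would produce both a strictly ascending and a strictly descending sequence of ideals
  (\<open>N_finite_modulo_square\<close>).
\<close>

section \<open>Products of subspaces\<close>

context nonassoc_algebra
begin

lemma mul_zero_left [simp]: "0 \<odot> x = 0"
  using mul_add_left[of 0 0 x] by simp

lemma mul_zero_right [simp]: "x \<odot> 0 = 0"
  using mul_add_right[of x 0 0] by simp

lemma mul_minus_left: "(- x) \<odot> y = - (x \<odot> y)"
  using mul_add_left[of x "- x" y] by (simp add: eq_neg_iff_add_eq_0 add.commute)

lemma mul_minus_right: "x \<odot> (- y) = - (x \<odot> y)"
  using mul_add_right[of x y "- y"] by (simp add: eq_neg_iff_add_eq_0 add.commute)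

lemma mul_diff_left: "(x - y) \<odot> z = x \<odot> z - y \<odot> z"
  using mul_add_left[of x "- y" z] by (simp add: mul_minus_left)

lemma mul_diff_right: "x \<odot> (y - z) = x \<odot> y - x \<odot> z"
  using mul_add_right[of x y "- z"] by (simp add: mul_minus_right)

lemma double_eq_zero:
  assumes "(2::'k) \<noteq> 0" "x + x = 0"
  shows "x = (0::'a)"
  using assms by (metis one_add_one scale_eq_0_iff scale_left_distrib scale_one)

lemma subspace_mul_left_vimage: "subspace Z \<Longrightarrow> subspace {x. x \<odot> y \<in> Z}"
  by (auto simp: subspace_def mul_add_left mul_scale_left)

lemma subspace_mul_right_vimage: "subspace Z \<Longrightarrow> subspace {y. x \<odot> y \<in> Z}"
  by (auto simp: subspace_def mul_add_right mul_scale_right)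

lemma mul_span_left:
  assumes "x \<in> span X" "subspace Z" "\<And>x. x \<in> X \<Longrightarrow> x \<odot> y \<in> Z"
  shows "x \<odot> y \<in> Z"
  using span_minimal[OF _ subspace_mul_left_vimage[OF assms(2)], of X y] assms by auto

lemma mul_span_right:
  assumes "y \<in> span Y" "subspace Z" "\<And>y. y \<in> Y \<Longrightarrow> x \<odot> y \<in> Z"
  shows "x \<odot> y \<in> Z"
  using span_minimal[OF _ subspace_mul_right_vimage[OF assms(2)], of Y x] assms by auto

lemma subspace_subspace_prod [simp]: "subspace (subspace_prod X Y)"
  by (simp add: subspace_prod_def)

lemma subspace_prodI: "x \<in> X \<Longrightarrow> y \<in> Y \<Longrightarrow> x \<odot> y \<in> subspace_prod X Y"
  unfolding subspace_prod_def by (rule span_base) auto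

lemma subspace_prod_subset:
  assumes "subspace Z" "\<And>x y. x \<in> X \<Longrightarrow> y \<in> Y \<Longrightarrow> x \<odot> y \<in> Z"
  shows "subspace_prod X Y \<subseteq> Z"
  unfolding subspace_prod_def by (rule span_minimal) (use assms in auto)

lemma subspace_prod_mono:
  "X \<subseteq> X' \<Longrightarrow> Y \<subseteq> Y' \<Longrightarrow> subspace_prod X Y \<subseteq> subspace_prod X' Y'"
  by (rule subspace_prod_subset) (auto intro: subspace_prodI)

lemma subspace_prod_subset_right:
  assumes "subspace Z" "\<And>a x y. a \<in> A \<Longrightarrow> x \<in> X \<Longrightarrow> y \<in> Y \<Longrightarrow> a \<odot> (x \<odot> y) \<in> Z"
  shows "subspace_prod A (subspace_prod X Y) \<subseteq> Z"
proof (rule subspace_prod_subset[OF assms(1)])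
  fix a z assume "a \<in> A" "z \<in> subspace_prod X Y"
  then show "a \<odot> z \<in> Z"
    unfolding subspace_prod_def by (elim mul_span_right) (use assms in auto)
qed

end

section \<open>Lower central series and derived series of mock-Lie algebras\<close>

text \<open>
  Commutative algebras satisfying the Jacobi identity are called mock-Lie algebras; away from
  characteristics 2 and 3 they are the Jordan algebras in which every cube vanishes.  The algebra
  sits on a subspace \<open>N\<close> of the ambient type, because the quotient of a Bernstein algebra to which
  this section is applied is realised on a complement of the ideal that is factored out.
\<close>
locale mock_lie = nonassoc_algebra scale mul
  for scale :: "'k::field \<Rightarrow> 'a::ab_group_add \<Rightarrow> 'a" (infixr "*s" 75)
    and mul :: "'a \<Rightarrow> 'a \<Rightarrow> 'a" (infixl "\<odot>" 70) +
  fixes N :: "'a set"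
  assumes subspace_N: "subspace N"
    and N_closed: "x \<in> N \<Longrightarrow> y \<in> N \<Longrightarrow> x \<odot> y \<in> N"
    and N_commute: "x \<in> N \<Longrightarrow> y \<in> N \<Longrightarrow> x \<odot> y = y \<odot> x"
    and jacobi: "x \<in> N \<Longrightarrow> y \<in> N \<Longrightarrow> z \<in> N \<Longrightarrow>
      x \<odot> (y \<odot> z) + y \<odot> (z \<odot> x) + z \<odot> (x \<odot> y) = 0"
    and two_nonzero: "(2::'k) \<noteq> 0"
begin

definition N_ideal :: "'a set \<Rightarrow> bool"
  where "N_ideal H \<longleftrightarrow> subspace H \<and> H \<subseteq> N \<and> subspace_prod N H \<subseteq> H"

abbreviation N_power :: "nat \<Rightarrow> 'a set \<Rightarrow> 'a set"
  where "N_power n Y \<equiv> (subspace_prod N ^^ n) Y"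

text \<open>
  What finite codimension of \<open>H\<close> will provide: modulo \<open>H Y\<close>, the algebra \<open>N\<close> acts nilpotently on every
  ideal \<open>Y\<close>, with an exponent depending on \<open>H\<close> alone.
\<close>
definition dominates_N_powers :: "'a set \<Rightarrow> bool"
  where "dominates_N_powers H \<longleftrightarrow>
    (\<exists>n. \<forall>Y. N_ideal Y \<longrightarrow> N_power n Y \<subseteq> subspace_prod H Y)"

lemma N_ideal_mul: "N_ideal H \<Longrightarrow> x \<in> N \<Longrightarrow> h \<in> H \<Longrightarrow> x \<odot> h \<in> H"
  unfolding N_ideal_def using subspace_prodI by blast

lemma N_ideal_N: "N_ideal N"
  unfolding N_ideal_def by (simp add: subspace_N subspace_prod_subset N_closed)

text \<open>
  The Jacobi identity says that multiplication operators anticommute up to multiplication by the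
  product of their arguments; all reordering below uses this form.
\<close>
lemma mul_mul_swap:
  assumes "x \<in> N" "h \<in> N" "y \<in> N"
  shows "x \<odot> (h \<odot> y) = - (h \<odot> (x \<odot> y)) - (x \<odot> h) \<odot> y"
  using jacobi[OF assms] N_commute[OF assms(1,3)] N_commute[OF N_closed[OF assms(1,2)] assms(3)]
  by (simp add: eq_diff_eq eq_neg_iff_add_eq_0 algebra_simps)

lemma N_ideal_prod:
  assumes "N_ideal H" "N_ideal Y"
  shows "N_ideal (subspace_prod H Y)"
proof -
  have HY: "H \<subseteq> N" "Y \<subseteq> N" using assms by (auto simp: N_ideal_def)
  have "subspace_prod N (subspace_prod H Y) \<subseteq> subspace_prod H Y"
  proof (rule subspace_prod_subset_right)
    fix x h y assume *: "x \<in> N" "h \<in> H" "y \<in> Y"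
    then have "x \<odot> (h \<odot> y) = - (h \<odot> (x \<odot> y)) - (x \<odot> h) \<odot> y"
      using HY by (intro mul_mul_swap) auto
    moreover have "h \<odot> (x \<odot> y) \<in> subspace_prod H Y" "(x \<odot> h) \<odot> y \<in> subspace_prod H Y"
      using * assms by (auto intro: subspace_prodI N_ideal_mul)
    ultimately show "x \<odot> (h \<odot> y) \<in> subspace_prod H Y"
      by (simp add: subspace_diff subspace_neg)
  qed simp
  moreover have "subspace_prod H Y \<subseteq> N"
    using HY by (intro subspace_prod_subset subspace_N) (auto intro: N_closed)
  ultimately show ?thesis by (simp add: N_ideal_def)
qed

lemma N_ideal_N_power: "N_ideal Y \<Longrightarrow> N_ideal (N_power n Y)"
  by (induction n) (auto intro: N_ideal_prod N_ideal_N)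

lemma N_power_mono: "X \<subseteq> Y \<Longrightarrow> N_power n X \<subseteq> N_power n Y"
  by (induction n) (auto intro: subspace_prod_mono[THEN subsetD])

text \<open>
  The reason why a finite-dimensional quotient acts nilpotently.  For \<open>H = K x + H'\<close>, reordering
  carries every element of \<open>H'\<close> to the front, so only \<open>x (x y)\<close> could escape \<open>H' Y\<close>; but the
  Jacobi identity gives \<open>2 x (x y) = - (x x) y\<close>, and \<open>x x\<close> lies in \<open>H'\<close>.
\<close>
lemma square_of_extension:
  assumes H': "N_ideal H'" and Y: "N_ideal Y" and x: "x \<in> N" "x \<odot> x \<in> H'"
    and H: "H \<subseteq> span (insert x H')"
  shows "subspace_prod H (subspace_prod H Y) \<subseteq> subspace_prod H' Y"
proof (rule subspace_prod_subset_right)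
  let ?Z = "subspace_prod H' Y"
  have sub: "subspace H'" "H' \<subseteq> N" "Y \<subseteq> N" using H' Y by (auto simp: N_ideal_def)
  have split: "\<exists>k h. z = k *s x + h \<and> h \<in> H'" if "z \<in> H" for z
  proof -
    have "z \<in> span (insert x H')" using that H by blast
    then obtain k where "z - k *s x \<in> span H'"
      unfolding span_breakdown_eq by (elim exE)
    then have "z - k *s x \<in> H'" using span_eq_iff sub(1) by blast
    moreover have "z = k *s x + (z - k *s x)" by simp
    ultimately show ?thesis by blast
  qed
  fix a b y assume "a \<in> H" "b \<in> H" and y: "y \<in> Y"
  then obtain j h k h' where a: "a = j *s x + h" "h \<in> H'" and b: "b = k *s x + h'" "h' \<in> H'"
    using split by metis
  have xxy: "x \<odot> (x \<odot> y) \<in> ?Z"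
  proof -
    have "x \<odot> (x \<odot> y) + x \<odot> (x \<odot> y) = - ((x \<odot> x) \<odot> y)"
    proof -
      have "x \<odot> (x \<odot> y) = - (x \<odot> (x \<odot> y)) - (x \<odot> x) \<odot> y"
        using x y sub by (intro mul_mul_swap) auto
      then show ?thesis
        unfolding eq_iff_diff_eq_0[of "x \<odot> (x \<odot> y)"] by (simp add: eq_neg_iff_add_eq_0 algebra_simps)
    qed
    then have "2 *s (x \<odot> (x \<odot> y)) = - ((x \<odot> x) \<odot> y)"
      by (metis one_add_one scale_left_distrib scale_one)
    then have "x \<odot> (x \<odot> y) = (1/2) *s (- ((x \<odot> x) \<odot> y))"
      using two_nonzero by (metis divide_self_if scale_one scale_scale times_divide_eq_left mult_1)
    then show ?thesis
      by (metis x(2) y subspace_prodI subspace_neg subspace_scale subspace_subspace_prod)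
  qed
  have bY: "b \<odot> y \<in> Y"
    using Y b sub x y by (auto intro!: N_ideal_mul subspace_add[OF subspace_N] subspace_scale[OF subspace_N])
  have "x \<odot> (h' \<odot> y) = - (h' \<odot> (x \<odot> y)) - (x \<odot> h') \<odot> y"
    using b sub x y by (intro mul_mul_swap) auto
  moreover have "h' \<odot> (x \<odot> y) \<in> ?Z" "(x \<odot> h') \<odot> y \<in> ?Z"
    using b x y H' Y by (auto intro: subspace_prodI N_ideal_mul)
  ultimately have "x \<odot> (h' \<odot> y) \<in> ?Z" by (simp add: subspace_diff subspace_neg)
  moreover have "x \<odot> (b \<odot> y) = k *s (x \<odot> (x \<odot> y)) + x \<odot> (h' \<odot> y)"
    by (simp add: b mul_add_left mul_add_right mul_scale_left mul_scale_right)
  ultimately have "x \<odot> (b \<odot> y) \<in> ?Z"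
    using xxy by (simp add: subspace_add subspace_scale)
  moreover have "a \<odot> (b \<odot> y) = j *s (x \<odot> (b \<odot> y)) + h \<odot> (b \<odot> y)"
    by (simp add: a mul_add_left mul_scale_left)
  ultimately show "a \<odot> (b \<odot> y) \<in> ?Z"
    using a bY by (simp add: subspace_add subspace_scale subspace_prodI)
qed simp

lemma dominates_N_powers_N: "dominates_N_powers N"
  unfolding dominates_N_powers_def by (intro exI[of _ 1]) auto

lemma dominates_N_powers_mono:
  "dominates_N_powers H \<Longrightarrow> H \<subseteq> H' \<Longrightarrow> dominates_N_powers H'"
  unfolding dominates_N_powers_def using subspace_prod_mono[OF _ subset_refl] by (meson subset_trans)

lemma dominates_N_powers_descend_one:
  assumes dom: "dominates_N_powers H" and H': "N_ideal H'" and x: "x \<in> N" "x \<odot> x \<in> H'"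
    and H: "H \<subseteq> span (insert x H')"
  shows "dominates_N_powers H'"
proof -
  obtain n where n: "\<And>Y. N_ideal Y \<Longrightarrow> N_power n Y \<subseteq> subspace_prod H Y"
    using dom by (auto simp: dominates_N_powers_def)
  have "N_power (n + n) Y \<subseteq> subspace_prod H' Y" if Y: "N_ideal Y" for Y
  proof -
    have "N_power (n + n) Y = N_power n (N_power n Y)" by (simp add: funpow_add)
    also have "\<dots> \<subseteq> subspace_prod H (N_power n Y)" by (intro n N_ideal_N_power Y)
    also have "\<dots> \<subseteq> subspace_prod H (subspace_prod H Y)"
      by (intro subspace_prod_mono n Y) simp
    also have "\<dots> \<subseteq> subspace_prod H' Y" by (rule square_of_extension) fact+
    finally show ?thesis .
  qed
  then show ?thesis unfolding dominates_N_powers_def by blast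
qed

text \<open>
  Since \<open>N H\<close> lies in \<open>H'\<close>, every subspace between \<open>H'\<close> and \<open>H\<close> is an ideal, so the finitely many
  generators of \<open>H\<close> modulo \<open>H'\<close> can be discarded one after the other.
\<close>
lemma dominates_N_powers_descend:
  assumes "finite F" "dominates_N_powers (span (F \<union> H'))"
    and H: "F \<subseteq> H" "N_ideal H" "subspace_prod N H \<subseteq> H'" and H': "N_ideal H'" "H' \<subseteq> H"
  shows "dominates_N_powers H'"
  using assms(1,2) H(1)
proof (induction F)
  case empty
  then show ?case using H' by (simp add: N_ideal_def span_eq_iff[THEN iffD2])
next
  case (insert x F)
  let ?K = "span (F \<union> H')"
  have HN: "subspace H" "H \<subseteq> N" using H(2) by (auto simp: N_ideal_def)
  have "?K \<subseteq> H" using insert.prems H' HN by (intro span_minimal) auto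
  then have "subspace_prod N ?K \<subseteq> H'" using H(3) subspace_prod_mono by blast
  then have "N_ideal ?K"
    using \<open>?K \<subseteq> H\<close> HN span_superset[of "F \<union> H'"] by (auto simp: N_ideal_def)
  moreover have "x \<odot> x \<in> ?K"
    using insert.prems HN H(3) by (intro span_base) (auto intro: subspace_prodI[THEN subsetD[OF H(3)]])
  moreover have "span (insert x F \<union> H') \<subseteq> span (insert x ?K)"
  proof (rule span_mono[OF subsetI])
    fix z assume "z \<in> insert x F \<union> H'"
    then show "z \<in> insert x ?K" using span_base[of z "F \<union> H'"] by blast
  qed
  ultimately have "dominates_N_powers ?K"
    using insert.prems HN by (intro dominates_N_powers_descend_one[of "span (insert x F \<union> H')" ?K x]) auto
  then show ?case using insert by auto
qed

lemma lower_central_antimono: "N_power (Suc n) N \<subseteq> N_power n N"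
  using N_ideal_N_power[OF N_ideal_N, of n] by (simp add: N_ideal_def)

text \<open>
  As for nilpotent algebras generated by \<open>F\<close>: a product \<open>p q\<close> acts on the \<open>n\<close>-th power as
  \<open>- p (q z) - q (p z)\<close>, two steps further down, hence only the action of \<open>F\<close> matters from each
  step to the next.
\<close>
lemma lower_central_finite_quotient:
  assumes F: "finite F" "F \<subseteq> N" "N \<subseteq> span (F \<union> subspace_prod N N)"
  shows "\<exists>G. finite G \<and> G \<subseteq> N_power n N \<and> N_power n N \<subseteq> span (G \<union> N_power (Suc n) N)"
proof (induction n)
  case 0
  then show ?case using F by auto
next
  case (Suc n)
  then obtain G where G: "finite G" "G \<subseteq> N_power n N" "N_power n N \<subseteq> span (G \<union> N_power (Suc n) N)"
    by blast
  have PN: "N_power n N \<subseteq> N" using N_ideal_N_power[OF N_ideal_N] by (auto simp: N_ideal_def)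
  let ?G = "(\<lambda>(f, g). f \<odot> g) ` (F \<times> G)"
  have "subspace_prod N (N_power n N) \<subseteq> span (?G \<union> subspace_prod N (N_power (Suc n) N))"
  proof (rule subspace_prod_subset)
    fix a z assume a: "a \<in> N" and z: "z \<in> N_power n N"
    show "a \<odot> z \<in> span (?G \<union> subspace_prod N (N_power (Suc n) N))"
    proof (rule mul_span_left[of a "F \<union> subspace_prod N N"])
      fix f assume "f \<in> F \<union> subspace_prod N N"
      then show "f \<odot> z \<in> span (?G \<union> subspace_prod N (N_power (Suc n) N))"
      proof
        assume f: "f \<in> F"
        show ?thesis
        proof (rule mul_span_right[of z "G \<union> N_power (Suc n) N"])
          fix g assume "g \<in> G \<union> N_power (Suc n) N"
          then show "f \<odot> g \<in> span (?G \<union> subspace_prod N (N_power (Suc n) N))"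
            using f F by (intro span_base) (auto intro: subspace_prodI simp del: funpow.simps(2))
        qed (use z G in auto)
      next
        assume f: "f \<in> subspace_prod N N"
        show ?thesis
        proof (rule mul_span_left[OF f[unfolded subspace_prod_def]])
          fix y assume "y \<in> {x \<odot> y |x y. x \<in> N \<and> y \<in> N}"
          then obtain p q where y: "y = p \<odot> q" "p \<in> N" "q \<in> N" by auto
          have zN: "z \<in> N" using z PN by auto
          have "y \<odot> z = - (p \<odot> (q \<odot> z)) - q \<odot> (p \<odot> z)"
            by (simp add: y(1) mul_mul_swap[OF y(2,3) zN])
          moreover have "p \<odot> (q \<odot> z) \<in> subspace_prod N (N_power (Suc n) N)"
            "q \<odot> (p \<odot> z) \<in> subspace_prod N (N_power (Suc n) N)"
            using y z by (auto intro!: subspace_prodI)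
          ultimately have "y \<odot> z \<in> subspace_prod N (N_power (Suc n) N)"
            by (simp add: subspace_diff subspace_neg)
          then show "y \<odot> z \<in> span (?G \<union> subspace_prod N (N_power (Suc n) N))"
            by (intro span_base) auto
        qed simp
      qed
    qed (use a F in auto)
  qed simp
  then have "N_power (Suc n) N \<subseteq> span (?G \<union> N_power (Suc (Suc n)) N)" by simp
  moreover have "finite ?G" "?G \<subseteq> N_power (Suc n) N"
    using F G by (auto intro: subspace_prodI)
  ultimately show ?case by blast
qed

lemma dominates_N_powers_lower_central:
  assumes F: "finite F" "F \<subseteq> N" "N \<subseteq> span (F \<union> subspace_prod N N)"
  shows "dominates_N_powers (N_power n N)"
proof (induction n)
  case 0
  then show ?case by (simp add: dominates_N_powers_N)
next
  case (Suc n)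
  obtain G where G: "finite G" "G \<subseteq> N_power n N" "N_power n N \<subseteq> span (G \<union> N_power (Suc n) N)"
    using lower_central_finite_quotient[OF F] by blast
  show ?case
  proof (rule dominates_N_powers_descend[OF G(1) _ G(2)])
    show "dominates_N_powers (span (G \<union> N_power (Suc n) N))"
      using Suc G(3) by (rule dominates_N_powers_mono)
  qed (use lower_central_antimono N_ideal_N_power[OF N_ideal_N] in \<open>auto simp del: funpow.simps(2)\<close>, simp_all)
qed

text \<open>
  If some power of \<open>N\<close> lies in an ideal \<open>D\<close>, then \<open>D\<close> has finite codimension and \<open>N\<close> acts
  nilpotently on \<open>D\<close> modulo \<open>D D\<close>; so a higher power lies in \<open>D D\<close>.  Thus finite generation turns
  solvability into nilpotency.
\<close>
theorem lower_central_below_derived: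
  assumes F: "finite F" "F \<subseteq> N" "N \<subseteq> span (F \<union> subspace_prod N N)"
  shows "\<exists>n. N_power n N \<subseteq> ((\<lambda>D. subspace_prod D D) ^^ r) N"
proof -
  let ?D = "\<lambda>r. ((\<lambda>D. subspace_prod D D) ^^ r) N"
  have "N_ideal (?D r) \<and> (\<exists>n. N_power n N \<subseteq> ?D r)" for r
  proof (induction r)
    case 0
    show ?case using N_ideal_N by (auto intro: exI[of _ 0])
  next
    case (Suc r)
    then obtain n where D: "N_ideal (?D r)" and n: "N_power n N \<subseteq> ?D r" by blast
    have "dominates_N_powers (?D r)"
      using dominates_N_powers_lower_central[OF F] n by (rule dominates_N_powers_mono)
    then obtain m where m: "N_power m (?D r) \<subseteq> subspace_prod (?D r) (?D r)"
      using D by (auto simp: dominates_N_powers_def)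
    have "N_power (m + n) N \<subseteq> N_power m (?D r)"
      using N_power_mono[OF n] by (simp add: funpow_add)
    then show ?case using m N_ideal_prod[OF D D] by (auto intro!: exI[of _ "m + n"])
  qed
  then show ?thesis by blast
qed

end

section \<open>Graded mock-Lie algebras with vanishing even product\<close>

text \<open>
  The Jacobi identity is split by degree: \<open>jacobi_UUU\<close>, \<open>skew\<close> (two arguments in \<open>U\<close>) and
  \<open>anticommute\<close> (one argument in \<open>U\<close>).  So \<open>U\<close> is a module over the exterior algebra of \<open>V\<close> with a
  symmetric form \<open>U \<times> U \<rightarrow> V\<close> for which \<open>V\<close> acts by skew operators.
\<close>
locale graded_mock_lie = nonassoc_algebra scale mul
  for scale :: "'k::field \<Rightarrow> 'a::ab_group_add \<Rightarrow> 'a" (infixr "*s" 75)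
    and mul :: "'a \<Rightarrow> 'a \<Rightarrow> 'a" (infixl "\<odot>" 70) +
  fixes U V :: "'a set"
  assumes subspace_U: "subspace U" and subspace_V: "subspace V"
    and UU: "a \<in> U \<Longrightarrow> b \<in> U \<Longrightarrow> a \<odot> b \<in> V"
    and VU: "v \<in> V \<Longrightarrow> a \<in> U \<Longrightarrow> v \<odot> a \<in> U"
    and VV: "v \<in> V \<Longrightarrow> w \<in> V \<Longrightarrow> v \<odot> w = 0"
    and UU_commute: "a \<in> U \<Longrightarrow> b \<in> U \<Longrightarrow> a \<odot> b = b \<odot> a"
    and UV_commute: "a \<in> U \<Longrightarrow> v \<in> V \<Longrightarrow> a \<odot> v = v \<odot> a"
    and jacobi_UUU: "a \<in> U \<Longrightarrow> b \<in> U \<Longrightarrow> c \<in> U \<Longrightarrow>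
      (a \<odot> b) \<odot> c + (b \<odot> c) \<odot> a + (c \<odot> a) \<odot> b = 0"
    and skew: "v \<in> V \<Longrightarrow> a \<in> U \<Longrightarrow> b \<in> U \<Longrightarrow> (v \<odot> a) \<odot> b = - (a \<odot> (v \<odot> b))"
    and anticommute: "v \<in> V \<Longrightarrow> w \<in> V \<Longrightarrow> a \<in> U \<Longrightarrow> v \<odot> (w \<odot> a) = - (w \<odot> (v \<odot> a))"
    and two_neq_zero: "(2::'k) \<noteq> 0" and three_neq_zero: "(3::'k) \<noteq> 0"
begin

lemmas double_zero = double_eq_zero[OF two_neq_zero]

lemma triple_zero: "x + x + x = 0 \<Longrightarrow> x = (0::'a)"
proof -
  assume "x + x + x = 0"
  moreover have "3 *s x = x + x + x"
    using scale_left_distrib[of 2 1 x] scale_left_distrib[of 1 1 x] by simp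
  ultimately show ?thesis using three_neq_zero by simp
qed

lemma cube_zero: "a \<in> U \<Longrightarrow> (a \<odot> a) \<odot> a = 0"
  by (rule triple_zero[OF jacobi_UUU])

lemma square_act:
  assumes "a \<in> U" "b \<in> U"
  shows "(a \<odot> a) \<odot> b = - ((a \<odot> b) \<odot> a) - ((a \<odot> b) \<odot> a)"
  using jacobi_UUU[of a a b] UU_commute[of b a] assms
  by (simp add: algebra_simps eq_neg_iff_add_eq_0 eq_diff_eq)

text \<open>
  Put \<open>m = a a\<close> and \<open>P x = w (v x)\<close>.  As a product of two anticommuting skew operators, \<open>P\<close> is
  skew and commutes with the action of \<open>V\<close>, and \<open>m a = 0\<close>.  The element \<open>((P a) b) (m c)\<close> is computed
  in two ways.  Rewriting \<open>m c = - 2 (a c) a\<close> gives the left-hand side of the claim; applying the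
  Jacobi identity to \<open>P a\<close>, \<open>b\<close>, \<open>m c\<close>, where \<open>(m c) (P a) = 0\<close> because \<open>m a = 0\<close>, gives its negative.
\<close>
lemma cubic_identity:
  assumes a: "a \<in> U" and b: "b \<in> U" and c: "c \<in> U" and v: "v \<in> V" and w: "w \<in> V"
  shows "w \<odot> (v \<odot> ((a \<odot> a) \<odot> ((a \<odot> b) \<odot> c))) = 0"
proof -
  define P where "P x = w \<odot> (v \<odot> x)" for x
  have PU: "P x \<in> U" if "x \<in> U" for x using that v w by (simp add: P_def VU)
  have P_comm: "z \<odot> P x = P (z \<odot> x)" if "z \<in> V" "x \<in> U" for z x
    using that v w by (simp add: P_def anticommute[of z w] anticommute[of z v] VU mul_minus_right)
  have P_skew: "P x \<odot> y = - (x \<odot> P y)" if "x \<in> U" "y \<in> U" for x y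
    using that v w skew[of w "v \<odot> x" y] skew[of v x "w \<odot> y"] anticommute[of w v y]
    by (simp add: P_def VU mul_minus_right)
  have P_minus: "P (- x) = - P x" and P_add: "P (x + y) = P x + P y" for x y
    by (simp_all add: P_def mul_minus_right mul_add_right)
  have P0: "P 0 = 0" by (simp add: P_def)
  define m where "m = a \<odot> a"
  define t where "t = P (m \<odot> ((a \<odot> b) \<odot> c))"
  note mem = a b c PU VU UU
  have mV: "m \<in> V" using a by (simp add: m_def UU)
  have ma: "m \<odot> a = 0" using a by (simp add: m_def cube_zero)
  have aPa: "a \<odot> P a = 0"
  proof (rule double_zero)
    have "P a \<odot> a + a \<odot> P a = 0" using P_skew[OF a a] by simp
    then show "a \<odot> P a + a \<odot> P a = 0" using UU_commute[OF PU[OF a] a] by simp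
  qed
  define k where "k = P a \<odot> b"
  have kV: "k \<in> V" using a b by (simp add: k_def mem)
  have mc: "m \<odot> c = - ((a \<odot> c) \<odot> a) - ((a \<odot> c) \<odot> a)"
    unfolding m_def using a c by (rule square_act)
  have mb: "(a \<odot> b) \<odot> a + (a \<odot> b) \<odot> a = - (m \<odot> b)"
    using square_act[OF a b] by (simp add: m_def)
  have k1: "k \<odot> (m \<odot> c) = t"
  proof -
    have ka: "k \<odot> a = - P ((a \<odot> b) \<odot> a)"
    proof -
      have "(P a \<odot> b) \<odot> a + (b \<odot> a) \<odot> P a + (a \<odot> P a) \<odot> b = 0"
        using a b by (intro jacobi_UUU mem)
      then show ?thesis using a b aPa UU_commute[OF b a] P_comm[of "a \<odot> b" a]
        by (simp add: k_def mem eq_neg_iff_add_eq_0)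
    qed
    have kac: "k \<odot> ((a \<odot> c) \<odot> a) = (a \<odot> c) \<odot> P ((a \<odot> b) \<odot> a)"
      using anticommute[of k "a \<odot> c" a] a c kV by (simp add: UU ka mul_minus_right)
    have "k \<odot> (m \<odot> c) = - ((a \<odot> c) \<odot> P ((a \<odot> b) \<odot> a + (a \<odot> b) \<odot> a))"
      by (simp add: mc mul_diff_right mul_minus_right kac P_add mul_add_right)
    also have "\<dots> = (a \<odot> c) \<odot> P (m \<odot> b)"
      unfolding mb by (simp add: P_minus mul_minus_right)
    also have "\<dots> = P ((a \<odot> c) \<odot> (m \<odot> b))"
      using a b c mV by (intro P_comm mem)
    also have "\<dots> = P (- (m \<odot> ((a \<odot> c) \<odot> b)))"
      using anticommute[of "a \<odot> c" m b] a b c mV by (simp add: mem)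
    also have "- (m \<odot> ((a \<odot> c) \<odot> b)) = m \<odot> ((a \<odot> b) \<odot> c)"
    proof -
      have "(a \<odot> b) \<odot> c + (b \<odot> c) \<odot> a + (a \<odot> c) \<odot> b = 0"
        using jacobi_UUU[OF a b c] UU_commute[OF c a] by simp
      then have "m \<odot> ((a \<odot> b) \<odot> c) + m \<odot> ((b \<odot> c) \<odot> a) + m \<odot> ((a \<odot> c) \<odot> b) = 0"
        by (metis mul_add_right mul_zero_right)
      moreover have "m \<odot> ((b \<odot> c) \<odot> a) = 0"
        using anticommute[of m "b \<odot> c" a] a b c mV ma by (simp add: UU)
      ultimately show ?thesis by (simp add: neg_eq_iff_add_eq_0 add.commute)
    qed
    finally show ?thesis by (simp add: t_def)
  qed
  have k2: "k \<odot> (m \<odot> c) = - t"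
  proof -
    have mcU: "m \<odot> c \<in> U" using mV c by (rule VU)
    have skew_ma: "(m \<odot> c) \<odot> x = - (c \<odot> (m \<odot> x))" if "x \<in> U" for x
      using mV c that by (rule skew)
    have "(m \<odot> c) \<odot> P a = 0"
      using skew_ma[of "P a"] a mV ma by (simp add: PU P_comm P0)
    moreover have "(P a \<odot> b) \<odot> (m \<odot> c) + (b \<odot> (m \<odot> c)) \<odot> P a + ((m \<odot> c) \<odot> P a) \<odot> b = 0"
      using a b mcU by (intro jacobi_UUU PU)
    ultimately have "k \<odot> (m \<odot> c) = - ((b \<odot> (m \<odot> c)) \<odot> P a)"
      by (simp add: k_def eq_neg_iff_add_eq_0)
    also have "(b \<odot> (m \<odot> c)) \<odot> P a = P ((b \<odot> (m \<odot> c)) \<odot> a)"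
      using a b mcU by (intro P_comm UU)
    also have "(b \<odot> (m \<odot> c)) \<odot> a = m \<odot> ((a \<odot> b) \<odot> c)"
    proof -
      have "(b \<odot> (m \<odot> c)) \<odot> a + ((m \<odot> c) \<odot> a) \<odot> b + (a \<odot> b) \<odot> (m \<odot> c) = 0"
        using b mcU a by (rule jacobi_UUU)
      moreover have "(m \<odot> c) \<odot> a = 0" using skew_ma[OF a] ma by simp
      moreover have "(a \<odot> b) \<odot> (m \<odot> c) = - (m \<odot> ((a \<odot> b) \<odot> c))"
        using a b c mV by (intro anticommute UU)
      ultimately show ?thesis by simp
    qed
    finally show ?thesis by (simp add: t_def)
  qed
  have "t = - t" using k1[symmetric] k2 by (rule trans)
  then have "t + t = t + - t" by (rule arg_cong)
  also have "\<dots> = 0" by simp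
  finally have "t + t = 0" .
  then have "t = 0" by (rule double_zero)
  then show ?thesis unfolding t_def P_def m_def .
qed

text \<open>
  Write \<open>T x y z q\<close> for \<open>w (v ((x y) ((z q) c)))\<close>.  It changes sign when the products \<open>x y\<close> and \<open>z q\<close> trade places.  Polarising
  \<open>cubic_identity\<close> in \<open>a\<close> expresses \<open>T x x y q\<close>, which is symmetric in \<open>y\<close> and \<open>q\<close>, as
  \<open>- 2 T x y x q\<close>, which is antisymmetric in them.
\<close>
lemma VVWW_zero:
  assumes a: "a \<in> U" and a': "a' \<in> U" and b: "b \<in> U" and d: "d \<in> U" and c: "c \<in> U"
    and v: "v \<in> V" and w: "w \<in> V"
  shows "w \<odot> (v \<odot> ((a \<odot> a') \<odot> ((b \<odot> d) \<odot> c))) = 0"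
proof -
  define T where "T x y z b = w \<odot> (v \<odot> ((x \<odot> y) \<odot> ((z \<odot> b) \<odot> c)))" for x y z b
  have T_add: "T (x + y) z p q = T x z p q + T y z p q" "T z (x + y) p q = T z x p q + T z y p q"
    "T z p (x + y) q = T z p x q + T z p y q" "T z p q (x + y) = T z p q x + T z p q y"
    "T (- x) z p q = - T x z p q" "T z (- x) p q = - T z x p q"
    "T z p (- x) q = - T z p x q" "T z p q (- x) = - T z p q x" for x y z p q
    by (simp_all add: T_def mul_add_left mul_add_right mul_minus_left mul_minus_right)
  have T_swap: "T x y z q = T y x z q" "T x y z q = T x y q z"
    if "x \<in> U" "y \<in> U" "z \<in> U" "q \<in> U" for x y z q
    using that by (simp_all add: T_def UU_commute)
  have T_exchange: "T x y z q = - T z q x y" if "x \<in> U" "y \<in> U" "z \<in> U" "q \<in> U" for x y z q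
    using that anticommute[of "x \<odot> y" "z \<odot> q" c] c by (simp add: T_def UU mul_minus_right)
  have T0: "T x x x q = 0" if "x \<in> U" "q \<in> U" for x q
    unfolding T_def using that c v w by (intro cubic_identity)
  \<comment> \<open>The part of \<open>T (x + y) (x + y) (x + y) q\<close> that is linear in \<open>y\<close>.\<close>
  have polar: "T x x y q = - T x y x q - T x y x q" if "x \<in> U" "y \<in> U" "q \<in> U" for x y q
  proof -
    have mem: "x + y \<in> U" "x + (- y) \<in> U" using that subspace_U
      by (auto intro: subspace_add subspace_neg simp del: add_uminus_conv_diff)
    let ?A = "T x x y q + T x y x q + T x y x q" and ?B = "T x y y q + T x y y q + T y y x q"
    note swap = T_swap(1)[of y x x q] T_swap(1)[of y x y q]
    have "?A + ?B = T (x + y) (x + y) (x + y) q"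
      using that swap T0[of x q] T0[of y q] by (simp add: T_add algebra_simps)
    moreover have "?B - ?A = T (x + - y) (x + - y) (x + - y) q"
      using that swap T0[of x q] T0[of y q]
      by (simp add: T_add algebra_simps del: add_uminus_conv_diff)
    ultimately have "?A + ?B = 0" "?B - ?A = 0" using mem that T0 by simp_all
    then have "?A + ?A = 0" by simp
    then have "T x x y q + T x y x q + T x y x q = 0" by (rule double_zero)
    then show ?thesis by (simp add: algebra_simps eq_neg_iff_add_eq_0 eq_diff_eq)
  qed
  have sq: "T x x y q = 0" if "x \<in> U" "y \<in> U" "q \<in> U" for x y q
  proof (rule double_zero)
    have "T x x y q = - T x y x q - T x y x q" using that by (intro polar)
    moreover have "T x x y q = - T x q x y - T x q x y"
      using polar[of x q y] that T_swap(2)[of x x y q] by simp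
    ultimately have "T x x y q + T x x y q = (- T x y x q - T x y x q) + (- T x q x y - T x q x y)"
      by metis
    also have "\<dots> = 0" using T_exchange[of x y x q] that by simp
    finally show "T x x y q + T x x y q = 0" .
  qed
  have "T (a + a') (a + a') b d = 0" using a a' b d subspace_U by (intro sq subspace_add)
  then have "T a a' b d + T a a' b d = 0"
    using sq[OF a b d] sq[OF a' b d] T_swap(1)[OF a' a b d] by (simp add: T_add)
  then have "T a a' b d = 0" by (rule double_zero)
  then show ?thesis by (simp add: T_def)
qed

definition N :: "'a set"
  where "N = {u + v | u v. u \<in> U \<and> v \<in> V}"

lemma N_cases: assumes "x \<in> N" obtains u v where "x = u + v" "u \<in> U" "v \<in> V"
  using assms by (auto simp: N_def)

lemma mock_lie_N: "mock_lie scale mul N"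
proof unfold_locales
  show "(2::'k) \<noteq> 0" by (rule two_neq_zero)
  have UV: "u \<odot> v \<in> U" if "u \<in> U" "v \<in> V" for u v
    using that VU[of v u] UV_commute[of u v] by simp
  show "subspace N"
    unfolding N_def using subspace_sums[OF subspace_U subspace_V] by simp
  fix x y assume x: "x \<in> N" and y: "y \<in> N"
  from x obtain u v where X: "x = u + v" "u \<in> U" "v \<in> V" by (rule N_cases)
  from y obtain u' v' where Y: "y = u' + v'" "u' \<in> U" "v' \<in> V" by (rule N_cases)
  have "x \<odot> y = (u \<odot> v' + v \<odot> u') + u \<odot> u'"
    using X Y VV by (simp add: mul_add_left mul_add_right algebra_simps)
  moreover have "u \<odot> v' + v \<odot> u' \<in> U" "u \<odot> u' \<in> V"
    using X Y by (auto intro: subspace_add subspace_U UV VU UU)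
  ultimately show "x \<odot> y \<in> N" by (auto simp: N_def)
  show "x \<odot> y = y \<odot> x"
    using X Y VV by (simp add: mul_add_left mul_add_right UU_commute[of u u'] UV_commute[of u v'] UV_commute[of u' v] algebra_simps)
  fix z assume z: "z \<in> N"
  from z obtain u'' v'' where Z: "z = u'' + v''" "u'' \<in> U" "v'' \<in> V" by (rule N_cases)
  define J where "J a b c = a \<odot> (b \<odot> c) + b \<odot> (c \<odot> a) + c \<odot> (a \<odot> b)" for a b c
  have J_add: "J (p + q) b c = J p b c + J q b c" "J b (p + q) c = J b p c + J b q c"
    "J b c (p + q) = J b c p + J b c q" for p q b c
    by (simp_all add: J_def mul_add_left mul_add_right)
  have J_rotate: "J a b c = J b c a" for a b c by (simp add: J_def)
  have UUU: "J a b c = 0" if "a \<in> U" "b \<in> U" "c \<in> U" for a b c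
    unfolding J_def
    using jacobi_UUU[OF that] that UV_commute[of a "b \<odot> c"] UV_commute[of b "c \<odot> a"]
      UV_commute[of c "a \<odot> b"] by (simp add: UU algebra_simps)
  have UUV: "J a b c = 0" "J b c a = 0" "J c a b = 0" if "a \<in> U" "b \<in> U" "c \<in> V" for a b c
  proof -
    show "J a b c = 0"
      unfolding J_def using skew[of c b a] that UU_commute[of "c \<odot> b" a] VV[of c "a \<odot> b"]
        UV_commute[of b c] by (simp add: UU VU)
    then show "J b c a = 0" "J c a b = 0" using J_rotate by metis+
  qed
  have UVV: "J a b c = 0" "J b c a = 0" "J c a b = 0" if "a \<in> U" "b \<in> V" "c \<in> V" for a b c
  proof -
    show "J a b c = 0"
      unfolding J_def using anticommute[of b c a] that VV[of b c] UV_commute[of a b] by (simp add: VU)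
    then show "J b c a = 0" "J c a b = 0" using J_rotate by metis+
  qed
  have VVV: "J a b c = 0" if "a \<in> V" "b \<in> V" "c \<in> V" for a b c
    using that by (simp add: J_def VV)
  have "J x y z = 0"
    unfolding X(1) Y(1) Z(1) J_add using X(2,3) Y(2,3) Z(2,3) by (simp add: UUU UUV UVV VVV)
  then show "x \<odot> (y \<odot> z) + y \<odot> (z \<odot> x) + z \<odot> (x \<odot> y) = 0" by (simp add: J_def)
qed

sublocale mock_lie scale mul N
  by (rule mock_lie_N)

text \<open>
  The derived series is followed through the subspaces \<open>V U + W\<close>, \<open>W (V U) + W\<close> and \<open>W (V U)\<close>, where
  \<open>W\<close> is spanned by the products of two elements of \<open>U\<close>.
\<close>
abbreviation "W \<equiv> subspace_prod U U"
abbreviation "VU_span \<equiv> subspace_prod V U"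
abbreviation "WVU_span \<equiv> subspace_prod W VU_span"

lemma W_subset: "W \<subseteq> V"
  by (rule subspace_prod_subset) (auto simp: subspace_V UU)

lemma VU_span_subset: "VU_span \<subseteq> U"
  by (rule subspace_prod_subset) (auto simp: subspace_U VU)

lemma WVU_span_subset: "WVU_span \<subseteq> VU_span"
  using W_subset VU_span_subset by (rule subspace_prod_mono)

lemma VVWW_span_zero:
  assumes x: "x \<in> W" and y: "y \<in> W" and v: "v \<in> V" "w \<in> V" and c: "c \<in> U"
  shows "w \<odot> (v \<odot> (x \<odot> (y \<odot> c))) = 0"
  using x[unfolded subspace_prod_def]
proof (induction x rule: span_induct)
  case (step x)
  then obtain a a' where X: "x = a \<odot> a'" "a \<in> U" "a' \<in> U" by auto
  from y[unfolded subspace_prod_def] show ?case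
  proof (induction y rule: span_induct)
    case (step y)
    then show ?case using X v c by (auto intro: VVWW_zero)
  qed (auto simp: subspace_def mul_add_left mul_add_right mul_scale_left mul_scale_right)
qed (auto simp: subspace_def mul_add_left mul_add_right mul_scale_left mul_scale_right)

text \<open>
  By skewness, \<open>(x (v a)) (y (w b))\<close> equals \<open>a (v (x (y (w b))))\<close>, where two operators from \<open>V\<close> and
  two from \<open>W\<close> act on \<open>b\<close>, and these anticommute.
\<close>
lemma WVU_square_zero:
  assumes p: "p \<in> WVU_span" and q: "q \<in> WVU_span"
  shows "p \<odot> q = 0"
proof -
  have gen: "(x \<odot> (v \<odot> a)) \<odot> (y \<odot> (w \<odot> b)) = 0"
    if "x \<in> W" "y \<in> W" "v \<in> V" "w \<in> V" "a \<in> U" "b \<in> U" for x y v w a b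
  proof -
    have xy: "x \<in> V" "y \<in> V" using that W_subset by auto
    have "(x \<odot> (v \<odot> a)) \<odot> (y \<odot> (w \<odot> b)) = a \<odot> (v \<odot> (x \<odot> (y \<odot> (w \<odot> b))))"
      using that xy by (simp add: skew VU)
    also have "x \<odot> (y \<odot> (w \<odot> b)) = w \<odot> (x \<odot> (y \<odot> b))"
      using that xy anticommute[of y w b] anticommute[of x w "y \<odot> b"] by (simp add: VU mul_minus_right)
    also have "v \<odot> (w \<odot> (x \<odot> (y \<odot> b))) = 0"
      using that by (intro VVWW_span_zero)
    finally show ?thesis by simp
  qed
  have gen2: "(x \<odot> r) \<odot> (y \<odot> s) = 0" if xy: "x \<in> W" "y \<in> W" and r: "r \<in> VU_span" and s: "s \<in> VU_span" for x y r s
    using r[unfolded subspace_prod_def[of V]]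
  proof (induction r rule: span_induct)
    case (step r)
    then obtain v a where R: "r = v \<odot> a" "v \<in> V" "a \<in> U" by auto
    from s[unfolded subspace_prod_def[of V]] show ?case
    proof (induction s rule: span_induct)
      case (step s)
      then show ?case using gen xy R by auto
    qed (auto simp: subspace_def mul_add_left mul_add_right mul_scale_left mul_scale_right)
  qed (auto simp: subspace_def mul_add_left mul_add_right mul_scale_left mul_scale_right)
  from p[unfolded subspace_prod_def[of W]] show ?thesis
  proof (induction p rule: span_induct)
    case (step p)
    then obtain x r where P: "p = x \<odot> r" "x \<in> W" "r \<in> VU_span" by auto
    from q[unfolded subspace_prod_def[of W]] show ?case
    proof (induction q rule: span_induct)
      case (step q)
      then show ?case using gen2 P by auto
    qed (auto simp: subspace_def mul_add_left mul_add_right mul_scale_left mul_scale_right)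
  qed (auto simp: subspace_def mul_add_left mul_add_right mul_scale_left mul_scale_right)
qed

lemma derived_eventually_zero: "((\<lambda>D. subspace_prod D D) ^^ 4) N \<subseteq> {0}"
proof -
  define S where "S X = {x + y | x y. x \<in> X \<and> y \<in> W}" for X
  have S_sub: "subspace (S X)" if "subspace X" for X
    unfolding S_def using subspace_sums[OF that subspace_subspace_prod] by simp
  have WV: "y \<in> V" if "y \<in> W" for y using that W_subset by auto
  have mulS: "(x + y) \<odot> (x' + y') = (y' \<odot> x + y \<odot> x') + x \<odot> x'"
    if "x \<in> U" "x' \<in> U" "y \<in> V" "y' \<in> V" for x x' y y'
    using that VV[of y y'] UV_commute[of x y'] by (simp add: mul_add_left mul_add_right algebra_simps)
  have D1: "subspace_prod N N \<subseteq> S VU_span"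
  proof (rule subspace_prod_subset)
    fix n n' assume "n \<in> N" "n' \<in> N"
    then obtain x y x' y' where n: "n = x + y" "x \<in> U" "y \<in> V" "n' = x' + y'" "x' \<in> U" "y' \<in> V"
      by (auto simp: N_def)
    then have "y' \<odot> x + y \<odot> x' \<in> VU_span" "x \<odot> x' \<in> W"
      by (auto intro!: subspace_add intro: subspace_prodI)
    then show "n \<odot> n' \<in> S VU_span" unfolding n(1,4) mulS[OF n(2,5,3,6)] S_def by blast
  qed (simp add: S_sub)
  have D2: "subspace_prod (S VU_span) (S VU_span) \<subseteq> S WVU_span"
  proof (rule subspace_prod_subset)
    fix n n' assume "n \<in> S VU_span" "n' \<in> S VU_span"
    then obtain x y x' y' where n: "n = x + y" "x \<in> VU_span" "y \<in> W" "n' = x' + y'" "x' \<in> VU_span" "y' \<in> W"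
      by (auto simp: S_def)
    then have "y' \<odot> x + y \<odot> x' \<in> WVU_span" "x \<odot> x' \<in> W"
      using VU_span_subset by (auto intro!: subspace_add intro: subspace_prodI)
    moreover have "n \<odot> n' = (y' \<odot> x + y \<odot> x') + x \<odot> x'"
      unfolding n(1,4) using n VU_span_subset WV by (intro mulS) auto
    ultimately show "n \<odot> n' \<in> S WVU_span" unfolding S_def by blast
  qed (simp add: S_sub)
  have D3: "subspace_prod (S WVU_span) (S WVU_span) \<subseteq> WVU_span"
  proof (rule subspace_prod_subset)
    fix n n' assume "n \<in> S WVU_span" "n' \<in> S WVU_span"
    then obtain x y x' y' where n: "n = x + y" "x \<in> WVU_span" "y \<in> W" "n' = x' + y'" "x' \<in> WVU_span" "y' \<in> W"
      by (auto simp: S_def)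
    then have "y' \<odot> x + y \<odot> x' \<in> WVU_span" "x \<odot> x' = 0"
      using WVU_span_subset WVU_square_zero
      by (auto intro!: subspace_add intro: subspace_prodI)
    moreover have "n \<odot> n' = (y' \<odot> x + y \<odot> x') + x \<odot> x'"
      unfolding n(1,4) using n VU_span_subset WVU_span_subset WV by (intro mulS) auto
    ultimately show "n \<odot> n' \<in> WVU_span" by simp
  qed simp
  have D4: "subspace_prod WVU_span WVU_span \<subseteq> {0}"
    by (rule subspace_prod_subset) (auto simp: WVU_square_zero)
  show ?thesis
    using subspace_prod_mono[OF D1 D1] subspace_prod_mono[OF D2 D2] subspace_prod_mono[OF D3 D3]
      D2 D3 D4
      subspace_prod_mono[OF subspace_prod_mono[OF D1 D1] subspace_prod_mono[OF D1 D1]]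
      subspace_prod_mono[OF subspace_prod_mono[OF D2 D2] subspace_prod_mono[OF D2 D2]]
      subspace_prod_mono[OF subspace_prod_mono[OF subspace_prod_mono[OF D1 D1] subspace_prod_mono[OF D1 D1]]
        subspace_prod_mono[OF subspace_prod_mono[OF D1 D1] subspace_prod_mono[OF D1 D1]]]
    by (simp add: numeral_eq_Suc)
qed

theorem finitely_generated_nilpotent:
  assumes "finite F" "F \<subseteq> N" "N \<subseteq> span (F \<union> subspace_prod N N)"
  shows "\<exists>n. N_power n N \<subseteq> {0}"
  using lower_central_below_derived[OF assms, of 4] derived_eventually_zero by blast

end

section \<open>Chain conditions and finite generation\<close>

context nonassoc_algebra
begin

text \<open>
  A projection along \<open>L\<close>, used to realise the quotient by \<open>L\<close> on a subspace of the same type.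
\<close>
lemma subspace_projection_exists:
  assumes L: "subspace L"
  obtains \<pi> where "\<And>x y. \<pi> (x + y) = \<pi> x + \<pi> y" "\<And>c x. \<pi> (c *s x) = c *s \<pi> x"
    "\<And>x. \<pi> x - x \<in> L" "\<And>x. x \<in> L \<Longrightarrow> \<pi> x = 0"
proof -
  interpret vector_space_pair scale scale ..
  obtain B where B: "B \<subseteq> L" "independent B" "L \<subseteq> span B"
    by (rule maximal_independent_subset)
  obtain C where C: "B \<subseteq> C" "independent C" "UNIV \<subseteq> span C"
    using maximal_independent_subset_extend[of B UNIV] B by auto
  obtain \<pi> where lin: "Vector_Spaces.linear scale scale \<pi>"
    and \<pi>: "\<And>x. x \<in> C \<Longrightarrow> \<pi> x = (if x \<in> B then 0 else x)"
    using linear_independent_extend[OF C(2), of "\<lambda>x. if x \<in> B then 0 else x"] by blast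
  interpret \<pi>: Vector_Spaces.linear scale scale \<pi> by fact
  have "\<pi> x - x \<in> L" for x
  proof -
    have "subspace {x. \<pi> x - x \<in> L}"
    proof (rule subspaceI)
      show "0 \<in> {x. \<pi> x - x \<in> L}" using subspace_0[OF L] by (simp add: \<pi>.zero)
    next
      fix x y assume "x \<in> {x. \<pi> x - x \<in> L}" "y \<in> {x. \<pi> x - x \<in> L}"
      then have "(\<pi> x - x) + (\<pi> y - y) \<in> L" by (auto intro: subspace_add[OF L])
      then show "x + y \<in> {x. \<pi> x - x \<in> L}" by (simp add: \<pi>.add algebra_simps)
    next
      fix c x assume "x \<in> {x. \<pi> x - x \<in> L}"
      then have "c *s (\<pi> x - x) \<in> L" by (auto intro: subspace_scale[OF L])
      then show "c *s x \<in> {x. \<pi> x - x \<in> L}" by (simp add: \<pi>.scale scale_right_diff_distrib)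
    qed
    moreover have "C \<subseteq> {x. \<pi> x - x \<in> L}"
      using B(1) \<pi> subspace_0[OF L] subspace_neg[OF L] by auto
    ultimately have "span C \<subseteq> {x. \<pi> x - x \<in> L}" by (intro span_minimal)
    then show ?thesis using C(3) by auto
  qed
  moreover have "\<pi> x = 0" if "x \<in> L" for x
  proof -
    have "subspace {x. \<pi> x = 0}"
      by (auto simp: subspace_def \<pi>.zero \<pi>.add \<pi>.scale)
    moreover have "B \<subseteq> {x. \<pi> x = 0}" using C(1) \<pi> by auto
    ultimately have "span B \<subseteq> {x. \<pi> x = 0}" by (intro span_minimal)
    then show ?thesis using that B(3) by auto
  qed
  ultimately show ?thesis using that \<pi>.add \<pi>.scale by blast
qed

lemma independent_sequence_modulo:
  assumes "\<And>F. finite F \<Longrightarrow> F \<subseteq> B \<Longrightarrow> \<not> B \<subseteq> span (F \<union> S)"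
  shows "\<exists>b. \<forall>n :: nat. b n \<in> B \<and> b n \<notin> span (b ` {..<n} \<union> S)"
proof (rule dependent_wf_choice[where R = "{(m, n). m < n}"
        and P = "\<lambda>b n r. r \<in> B \<and> r \<notin> span (b ` {..<n} \<union> S)"])
    show "wf {(m, n :: nat). m < n}" by (rule wf)
    show "(r \<in> B \<and> r \<notin> span (f ` {..<n} \<union> S)) = (r \<in> B \<and> r \<notin> span (g ` {..<n} \<union> S))"
      if "\<And>m. (m, n) \<in> {(m, n). m < n} \<Longrightarrow> f m = g m" for f g :: "nat \<Rightarrow> 'a" and n r
    proof -
      have "f ` {..<n} = g ` {..<n}" using that by (intro image_cong) auto
      then show ?thesis by simp
    qed
    show "\<exists>r. r \<in> B \<and> r \<notin> span (f ` {..<n} \<union> S)"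
      if "\<And>m. (m, n) \<in> {(m, n). m < n} \<Longrightarrow> f m \<in> B \<and> f m \<notin> span (f ` {..<m} \<union> S)"
      for f :: "nat \<Rightarrow> 'a" and n
      using assms[of "f ` {..<n}"] that by auto
qed

text \<open>
  By the exchange property, a sequence that is independent from the front is also independent from
  the back; this is what makes the descending chain of tails strict.
\<close>
lemma independent_sequence_tail:
  fixes b :: "nat \<Rightarrow> 'a"
  assumes b: "\<And>n. b n \<notin> span (b ` {..<n} \<union> S)"
  shows "b n \<notin> span (b ` {Suc n..} \<union> S)"
proof
  define T where "T k = span (b ` {Suc n..<Suc n + k} \<union> S)" for k
  have T_mono: "T j \<subseteq> T k" if "j \<le> k" for j k
    unfolding T_def using that by (intro span_mono Un_mono image_mono) auto
  have bT: "b n \<notin> T k" for k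
  proof (induction k)
    case 0
    have "T 0 \<subseteq> span (b ` {..<n} \<union> S)" unfolding T_def by (intro span_mono) auto
    then show ?case using b by auto
  next
    case (Suc k)
    show ?case
    proof
      assume "b n \<in> T (Suc k)"
      moreover have "b ` {Suc n..<Suc n + Suc k} = insert (b (Suc n + k)) (b ` {Suc n..<Suc n + k})"
        by (simp add: atLeastLessThanSuc)
      ultimately have "b n \<in> span (insert (b (Suc n + k)) (b ` {Suc n..<Suc n + k} \<union> S))"
        by (simp add: T_def)
      then have "b (Suc n + k) \<in> span (insert (b n) (b ` {Suc n..<Suc n + k} \<union> S))"
        using Suc unfolding T_def by (rule in_span_insert)
      also have "\<dots> \<subseteq> span (b ` {..<Suc n + k} \<union> S)" by (intro span_mono) auto
      finally show False using b by blast
    qed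
  qed
  have "subspace (\<Union>k. T k)"
  proof (rule subspaceI)
    show "0 \<in> (\<Union>k. T k)" by (auto simp: T_def span_zero)
  next
    fix x y assume "x \<in> (\<Union>k. T k)" "y \<in> (\<Union>k. T k)"
    then obtain i j where "x \<in> T i" "y \<in> T j" by auto
    then have "x \<in> T (max i j)" "y \<in> T (max i j)" using T_mono[OF max.cobounded1] T_mono[OF max.cobounded2] by blast+
    then show "x + y \<in> (\<Union>k. T k)" unfolding T_def by (blast intro: span_add)
  next
    fix c x assume "x \<in> (\<Union>k. T k)"
    then show "c *s x \<in> (\<Union>k. T k)" unfolding T_def by (blast intro: span_scale)
  qed
  moreover have "b ` {Suc n..} \<union> S \<subseteq> (\<Union>k. T k)"
  proof
    fix x assume "x \<in> b ` {Suc n..} \<union> S"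
    then show "x \<in> (\<Union>k. T k)"
    proof
      assume "x \<in> b ` {Suc n..}"
      then obtain i where "x = b i" "Suc n \<le> i" by auto
      then have "x \<in> T i" unfolding T_def by (intro span_base) auto
      then show ?thesis by blast
    next
      assume "x \<in> S"
      then have "x \<in> T 0" unfolding T_def by (intro span_base) auto
      then show ?thesis by blast
    qed
  qed
  ultimately have "span (b ` {Suc n..} \<union> S) \<subseteq> (\<Union>k. T k)" by (intro span_minimal)
  moreover assume "b n \<in> span (b ` {Suc n..} \<union> S)"
  ultimately show False using bT by blast
qed

lemma finite_spanning_modulo:
  assumes chain: "noetherian \<or> artinian"
    and ideals: "\<And>C. C \<subseteq> B \<Longrightarrow> ideal (span (C \<union> S))"
  shows "\<exists>F. finite F \<and> F \<subseteq> B \<and> B \<subseteq> span (F \<union> S)"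
proof (rule ccontr)
  assume "\<not> ?thesis"
  then have "\<And>F. finite F \<Longrightarrow> F \<subseteq> B \<Longrightarrow> \<not> B \<subseteq> span (F \<union> S)" by blast
  then obtain b :: "nat \<Rightarrow> 'a" where bB: "\<And>n. b n \<in> B" and b: "\<And>n. b n \<notin> span (b ` {..<n} \<union> S)"
    using independent_sequence_modulo[of B S] by blast
  from chain show False
  proof
    assume noetherian
    moreover have "ideal (span (b ` {..<n} \<union> S))" for n using bB by (intro ideals) auto
    moreover have "span (b ` {..<n} \<union> S) \<subseteq> span (b ` {..<Suc n} \<union> S)" for n
      by (intro span_mono Un_mono image_mono) auto
    ultimately obtain m where
      "\<And>n. n \<ge> m \<Longrightarrow> span (b ` {..<n} \<union> S) = span (b ` {..<m} \<union> S)"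
      unfolding noetherian_def by (elim allE[of _ "\<lambda>n. span (b ` {..<n} \<union> S)"]) auto
    from this[of "Suc m"] have "b m \<in> span (b ` {..<m} \<union> S)"
      using span_base[of "b m" "b ` {..<Suc m} \<union> S"] by auto
    then show False using b by blast
  next
    assume artinian
    moreover have "ideal (span (b ` {n..} \<union> S))" for n using bB by (intro ideals) auto
    moreover have "span (b ` {Suc n..} \<union> S) \<subseteq> span (b ` {n..} \<union> S)" for n
      by (intro span_mono Un_mono image_mono) auto
    ultimately obtain m where
      "\<And>n. n \<ge> m \<Longrightarrow> span (b ` {n..} \<union> S) = span (b ` {m..} \<union> S)"
      unfolding artinian_def by (elim allE[of _ "\<lambda>n. span (b ` {n..} \<union> S)"]) auto
    from this[of "Suc m"] have "b m \<in> span (b ` {Suc m..} \<union> S)"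
      using span_base[of "b m" "b ` {m..} \<union> S"] by auto
    then show False using independent_sequence_tail[OF b] by blast
  qed
qed

end

section \<open>Peirce decomposition of a Bernstein algebra\<close>


locale bernstein_peirce = bernstein_algebra scale mul \<omega>
  for scale :: "'k::field \<Rightarrow> 'a::ab_group_add \<Rightarrow> 'a" (infixr "*s" 75)
    and mul :: "'a \<Rightarrow> 'a \<Rightarrow> 'a" (infixl "\<odot>" 70)
    and \<omega> :: "'a \<Rightarrow> 'k" +
  fixes e :: 'a
  assumes e_nonzero: "e \<noteq> 0" and e_idem: "e \<odot> e = e"
    and two_nonzero: "(2::'k) \<noteq> 0" and three_nonzero: "(3::'k) \<noteq> 0"
begin

abbreviation "U \<equiv> peirce_U e"
abbreviation "V \<equiv> peirce_V e"
abbreviation "N \<equiv> barideal"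
abbreviation "L \<equiv> annihilator U U"

lemma weight_add: "\<omega> (x + y) = \<omega> x + \<omega> y" and weight_scale: "\<omega> (c *s x) = c * \<omega> x"
proof -
  interpret w: Vector_Spaces.linear scale "(*)" \<omega> by (rule weight_linear)
  show "\<omega> (x + y) = \<omega> x + \<omega> y" "\<omega> (c *s x) = c * \<omega> x" by (fact w.add, fact w.scale)
qed

lemma weight_zero: "\<omega> 0 = 0"
  using weight_scale[of 0 0] by simp

lemmas double_zero = double_eq_zero[OF two_nonzero]

lemma weight_e: "\<omega> e = 1"
proof -
  have "\<omega> e * \<omega> e = \<omega> e" using weight_mult[of e e] e_idem by simp
  moreover have "\<omega> e \<noteq> 0" using bernstein[of e] e_idem e_nonzero by auto
  ultimately show ?thesis by simp
qed

lemma subspace_N: "subspace N"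
  by (rule subspaceI) (auto simp: barideal_def weight_zero weight_add weight_scale)

lemma U_iff: "u \<in> U \<longleftrightarrow> e \<odot> u + e \<odot> u = u"
proof -
  have "(1/2) *s u + (1/2) *s u = u"
    using scale_left_distrib[of "1/2" "1/2" u] two_nonzero by (simp add: field_simps)
  moreover have "e \<odot> u + e \<odot> u = u \<Longrightarrow> (1/2) *s u = e \<odot> u"
  proof -
    assume "e \<odot> u + e \<odot> u = u"
    then have "(1/2) *s u = (1/2) *s (2 *s (e \<odot> u))"
      by (metis one_add_one scale_left_distrib scale_one)
    then show ?thesis using two_nonzero by simp
  qed
  ultimately show ?thesis unfolding peirce_U_def mem_Collect_eq by metis
qed

lemma V_iff: "v \<in> V \<longleftrightarrow> e \<odot> v = 0"
  by (simp add: peirce_V_def)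

lemma subspace_U: "subspace U"
  by (rule subspaceI) (auto simp: peirce_U_def mul_add_right mul_scale_right scale_right_distrib mult.commute)

lemma subspace_V: "subspace V"
  by (rule subspaceI) (auto simp: peirce_V_def mul_add_right mul_scale_right)

lemma U_subset_N: "U \<subseteq> N"
proof
  fix u assume "u \<in> U"
  then have "\<omega> (e \<odot> u) + \<omega> (e \<odot> u) = \<omega> u" by (metis U_iff weight_add)
  then have "\<omega> u + \<omega> u = \<omega> u" by (simp only: weight_mult weight_e mult_1)
  then show "u \<in> N" unfolding barideal_def mem_Collect_eq by (metis add_cancel_left_left)
qed

lemma V_subset_N: "V \<subseteq> N"
proof
  fix v assume "v \<in> V"
  then have "\<omega> e * \<omega> v = 0" using weight_zero by (simp add: peirce_V_def flip: weight_mult)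
  then show "v \<in> N" by (simp add: barideal_def weight_e)
qed

lemma U_V_disjoint: "x \<in> U \<Longrightarrow> x \<in> V \<Longrightarrow> x = 0"
  using U_iff V_iff by simp

text \<open>
  The Bernstein identity at \<open>e + c n\<close>, sorted by powers of \<open>c\<close>; the quartic term \<open>(n n) (n n)\<close>
  vanishes by the identity at \<open>n\<close>.
\<close>
lemma bernstein_expansion:
  assumes n: "n \<in> N"
  shows "c *s (e \<odot> (e \<odot> n) + e \<odot> (e \<odot> n) + (e \<odot> (e \<odot> n) + e \<odot> (e \<odot> n)) - (e \<odot> n + e \<odot> n))
    + (c * c) *s ((e \<odot> n + e \<odot> n) \<odot> (e \<odot> n + e \<odot> n) + (e \<odot> (n \<odot> n) + e \<odot> (n \<odot> n)) - n \<odot> n)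
    + (c * (c * c)) *s ((e \<odot> n + e \<odot> n) \<odot> (n \<odot> n) + (e \<odot> n + e \<odot> n) \<odot> (n \<odot> n)) = 0"
proof -
  define p where "p = e \<odot> n"
  define q where "q = n \<odot> n"
  have sq: "(e + c *s n) \<odot> (e + c *s n) = e + c *s (p + p) + (c * c) *s q"
    by (simp add: mul_add_left mul_add_right mul_scale_left mul_scale_right e_idem p_def q_def
        mul_commute[of n e] scale_right_distrib)
  have qq: "q \<odot> q = 0"
    using bernstein[of n] n by (simp add: q_def barideal_def)
  have "\<omega> (e + c *s n) = 1" using n by (simp add: weight_add weight_scale weight_e barideal_def)
  then have "(e + c *s (p + p) + (c * c) *s q) \<odot> (e + c *s (p + p) + (c * c) *s q)
      = e + c *s (p + p) + (c * c) *s q"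
    using bernstein[of "e + c *s n"] by (simp add: sq)
  then have "(e + c *s (p + p) + (c * c) *s q) \<odot> (e + c *s (p + p) + (c * c) *s q)
      - (e + c *s (p + p) + (c * c) *s q) = 0" by simp
  then show ?thesis
    unfolding p_def[symmetric] q_def[symmetric]
    by (simp add: mul_add_left mul_add_right mul_scale_left mul_scale_right e_idem qq
        mul_commute[of p e] mul_commute[of q e] mul_commute[of q p] scale_right_distrib
        scale_right_diff_distrib algebra_simps)
qed

text \<open>
  The values \<open>1\<close>, \<open>-1\<close> and \<open>2\<close> of \<open>c\<close> separate the three coefficients, as \<open>2\<close> and \<open>3\<close> are invertible.
\<close>
lemma bernstein_components:
  assumes n: "n \<in> N"
  shows "e \<odot> n \<in> U"
    and "(e \<odot> n + e \<odot> n) \<odot> (e \<odot> n + e \<odot> n) + (e \<odot> (n \<odot> n) + e \<odot> (n \<odot> n)) = n \<odot> n"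
    and "(e \<odot> n + e \<odot> n) \<odot> (n \<odot> n) = 0"
    and "(n \<odot> n) \<odot> (n \<odot> n) = 0"
proof -
  define E1 where "E1 = e \<odot> (e \<odot> n) + e \<odot> (e \<odot> n) + (e \<odot> (e \<odot> n) + e \<odot> (e \<odot> n)) - (e \<odot> n + e \<odot> n)"
  define E2 where "E2 = (e \<odot> n + e \<odot> n) \<odot> (e \<odot> n + e \<odot> n) + (e \<odot> (n \<odot> n) + e \<odot> (n \<odot> n)) - n \<odot> n"
  define E3 where "E3 = (e \<odot> n + e \<odot> n) \<odot> (n \<odot> n) + (e \<odot> n + e \<odot> n) \<odot> (n \<odot> n)"
  have E: "c *s E1 + (c * c) *s E2 + (c * (c * c)) *s E3 = 0" for c
    unfolding E1_def E2_def E3_def using n by (rule bernstein_expansion)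
  have e1: "E1 + E2 + E3 = 0" using E[of 1] by simp
  have "- E1 + E2 - E3 = 0" using E[of "-1"] by simp
  with e1 have "(E1 + E2 + E3) + (- E1 + E2 - E3) = 0" by simp
  then have E2: "E2 = 0" by - (rule double_zero, simp)
  have E13: "E1 = - E3" using e1 E2 by (simp add: eq_neg_iff_add_eq_0)
  have "(2 * (2 * 2)) *s E3 - 2 *s E3 = 0" using E[of 2] unfolding E13 E2 by simp
  then have "(2 * (2 * 2) - 2) *s E3 = 0" by (simp only: scale_left_diff_distrib)
  moreover have "(2 * (2 * 2) - 2 :: 'k) = 2 * 3" by simp
  ultimately have E3: "E3 = 0" using two_nonzero three_nonzero by (metis mult_eq_0_iff scale_eq_0_iff)
  have "E1 = 0" using E13 E3 by simp
  then have "e \<odot> (e \<odot> n) + e \<odot> (e \<odot> n) - e \<odot> n + (e \<odot> (e \<odot> n) + e \<odot> (e \<odot> n) - e \<odot> n) = 0"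
    by (simp add: E1_def algebra_simps)
  then have "e \<odot> (e \<odot> n) + e \<odot> (e \<odot> n) - e \<odot> n = 0" by (rule double_zero)
  then show "e \<odot> n \<in> U" by (simp add: U_iff)
  show "(e \<odot> n + e \<odot> n) \<odot> (e \<odot> n + e \<odot> n) + (e \<odot> (n \<odot> n) + e \<odot> (n \<odot> n)) = n \<odot> n"
    using E2 by (simp add: E2_def)
  show "(e \<odot> n + e \<odot> n) \<odot> (n \<odot> n) = 0"
    using E3 unfolding E3_def by (rule double_zero)
  show "(n \<odot> n) \<odot> (n \<odot> n) = 0"
    using bernstein[of n] n by (simp add: barideal_def)
qed

lemma N_decomposition:
  assumes "n \<in> N" obtains u v where "n = u + v" "u \<in> U" "v \<in> V"
proof
  have U: "e \<odot> n \<in> U" using assms by (rule bernstein_components(1))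
  then show "e \<odot> n + e \<odot> n \<in> U" by (intro subspace_add subspace_U)
  show "n - (e \<odot> n + e \<odot> n) \<in> V"
    using U unfolding V_iff U_iff by (simp add: mul_diff_right mul_add_right)
qed simp

lemma U_V_in_N: "u \<in> U \<Longrightarrow> u \<in> N" "v \<in> V \<Longrightarrow> v \<in> N" "u \<in> U \<Longrightarrow> v \<in> V \<Longrightarrow> u + v \<in> N"
  using U_subset_N V_subset_N subspace_N by (auto intro: subspace_add)

lemma peirce_components:
  assumes u: "u \<in> U" and v: "v \<in> V"
  shows "u \<odot> u + (e \<odot> ((u + v) \<odot> (u + v)) + e \<odot> ((u + v) \<odot> (u + v))) = (u + v) \<odot> (u + v)"
    and "u \<odot> ((u + v) \<odot> (u + v)) = 0"
proof -
  have n: "u + v \<in> N" using assms by (rule U_V_in_N)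
  have "e \<odot> (u + v) + e \<odot> (u + v) = u"
    using assms by (simp add: mul_add_right U_iff V_iff)
  then show "u \<odot> u + (e \<odot> ((u + v) \<odot> (u + v)) + e \<odot> ((u + v) \<odot> (u + v))) = (u + v) \<odot> (u + v)"
    and "u \<odot> ((u + v) \<odot> (u + v)) = 0"
    using bernstein_components(2,3)[OF n] by simp_all
qed

lemma zero_U [simp]: "0 \<in> U" and zero_V [simp]: "0 \<in> V"
  using subspace_U subspace_V by (auto intro: subspace_0)

lemma square_polarize: "(x + y) \<odot> (x + y) = x \<odot> x + (x \<odot> y + x \<odot> y) + y \<odot> y"
  by (simp add: mul_add_left mul_add_right mul_commute[of y x] algebra_simps)

lemma UU_in_V:
  assumes "u \<in> U" "u' \<in> U" shows "u \<odot> u' \<in> V"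
proof -
  have sq: "e \<odot> (x \<odot> x) = 0" if "x \<in> U" for x
    using peirce_components(1)[OF that zero_V] by - (rule double_zero, simp)
  have "e \<odot> ((u + u') \<odot> (u + u')) = 0" using assms by (intro sq subspace_add subspace_U)
  then have "e \<odot> (u \<odot> u') + e \<odot> (u \<odot> u') = 0"
    using sq[OF assms(1)] sq[OF assms(2)] unfolding square_polarize by (simp add: mul_add_right)
  then show ?thesis unfolding V_iff by (rule double_zero)
qed

lemma VV_square_in_U: "v \<in> V \<Longrightarrow> v \<odot> v \<in> U"
  using peirce_components(1)[OF zero_U, of v] by (simp add: U_iff)

lemma halve_in_U:
  assumes "x + x \<in> U" shows "x \<in> U"
proof -
  have "(e \<odot> x + e \<odot> x - x) + (e \<odot> x + e \<odot> x - x) = 0"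
    using assms unfolding U_iff by (simp add: mul_add_right algebra_simps)
  then have "e \<odot> x + e \<odot> x - x = 0" by (rule double_zero)
  then show ?thesis by (simp add: U_iff)
qed

lemma VV_in_U:
  assumes "v \<in> V" "w \<in> V" shows "v \<odot> w \<in> U"
proof -
  have "(v + w) \<odot> (v + w) - v \<odot> v - w \<odot> w \<in> U"
    using assms by (intro subspace_diff subspace_U VV_square_in_U subspace_add subspace_V)
  then have "v \<odot> w + v \<odot> w \<in> U" by (simp add: square_polarize)
  then show ?thesis by (rule halve_in_U)
qed

lemma UV_in_U:
  assumes u: "u \<in> U" and v: "v \<in> V" shows "u \<odot> v \<in> U"
proof -
  define d where "d = u \<odot> v + u \<odot> v"
  define y where "y = e \<odot> (v \<odot> v)"
  have uu: "e \<odot> (u \<odot> u) = 0" and vv: "v \<odot> v = y + y"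
    using UU_in_V[OF u u] VV_in_U[OF v v] by (auto simp: U_iff V_iff y_def)
  have S: "(u + v) \<odot> (u + v) = u \<odot> u + d + v \<odot> v"
    by (simp add: square_polarize d_def)
  have "e \<odot> ((u + v) \<odot> (u + v)) = e \<odot> d + y"
    unfolding S by (simp add: mul_add_right uu y_def)
  then have "u \<odot> u + (e \<odot> d + y + (e \<odot> d + y)) = u \<odot> u + d + (y + y)"
    using peirce_components(1)[OF u v] unfolding S vv by simp
  then have "e \<odot> d + e \<odot> d = d" by (simp add: algebra_simps)
  then have "d \<in> U" by (simp only: U_iff)
  then show ?thesis unfolding d_def by (rule halve_in_U)
qed

lemma cubic_relations:
  assumes u: "u \<in> U" and v: "v \<in> V"
  shows "u \<odot> (u \<odot> u) = 0" "u \<odot> (u \<odot> v) = 0" "u \<odot> (v \<odot> v) = 0"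
proof -
  show uuu: "u \<odot> (u \<odot> u) = 0" using peirce_components(2)[OF u zero_V] by simp
  have plus: "(u \<odot> (u \<odot> v) + u \<odot> (u \<odot> v)) + u \<odot> (v \<odot> v) = 0"
    using peirce_components(2)[OF u v] uuu unfolding square_polarize by (simp add: mul_add_right)
  moreover have "- v \<in> V" using v by (intro subspace_neg subspace_V)
  then have "- (u \<odot> (u \<odot> v) + u \<odot> (u \<odot> v)) + u \<odot> (v \<odot> v) = 0"
    using peirce_components(2)[OF u, of "- v"] uuu unfolding square_polarize
    by (simp add: mul_add_right mul_diff_right mul_minus_right mul_minus_left)
  ultimately have "((u \<odot> (u \<odot> v) + u \<odot> (u \<odot> v)) + u \<odot> (v \<odot> v)) +
    (- (u \<odot> (u \<odot> v) + u \<odot> (u \<odot> v)) + u \<odot> (v \<odot> v)) = 0" by simp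
  then show uvv: "u \<odot> (v \<odot> v) = 0" by - (rule double_zero, simp)
  show "u \<odot> (u \<odot> v) = 0" using plus uvv by - (rule double_zero, simp)
qed

lemma cyclic_UUU:
  assumes "a \<in> U" "b \<in> U" "c \<in> U"
  shows "(a \<odot> b) \<odot> c + (b \<odot> c) \<odot> a + (c \<odot> a) \<odot> b = 0"
proof -
  define f where "f x = x \<odot> (x \<odot> x)" for x
  have f: "f x = 0" if "x \<in> U" for x
    using cubic_relations(1)[OF that zero_V] by (simp add: f_def)
  let ?s = "a \<odot> (b \<odot> c) + b \<odot> (c \<odot> a) + c \<odot> (a \<odot> b)"
  have "f (a + b + c) - f (a + b) - f (b + c) - f (a + c) + f a + f b + f c = ?s + ?s"
    unfolding f_def
    by (simp add: mul_add_left mul_add_right mul_commute[of b a] mul_commute[of c b]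
        mul_commute[of a c] algebra_simps)
  then have "?s + ?s = 0"
    using assms subspace_U by (simp add: f subspace_add)
  then have "?s = 0" by (rule double_zero)
  then show ?thesis
    by (simp add: mul_commute[of "a \<odot> b" c] mul_commute[of "b \<odot> c" a] mul_commute[of "c \<odot> a" b]
        algebra_simps)
qed

lemma skew_UUV:
  assumes "a \<in> U" "b \<in> U" "v \<in> V"
  shows "a \<odot> (b \<odot> v) = - (b \<odot> (a \<odot> v))"
proof -
  have "(a + b) \<odot> ((a + b) \<odot> v) = 0" using assms subspace_U
    by (intro cubic_relations(2)) (auto intro: subspace_add)
  then show ?thesis
    using cubic_relations(2)[OF assms(1,3)] cubic_relations(2)[OF assms(2,3)]
    by (simp add: mul_add_left mul_add_right eq_neg_iff_add_eq_0 add.commute)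
qed

lemma subspace_L: "subspace L"
  using subspace_U by (auto simp: annihilator_def subspace_def mul_add_left mul_scale_left)

lemma L_D: "l \<in> L \<Longrightarrow> l \<in> U" "l \<in> L \<Longrightarrow> u \<in> U \<Longrightarrow> l \<odot> u = 0"
  by (auto simp: annihilator_def)

lemma L_I: "l \<in> U \<Longrightarrow> (\<And>u. u \<in> U \<Longrightarrow> u \<odot> l = 0) \<Longrightarrow> l \<in> L"
  by (auto simp: annihilator_def mul_commute)

lemma halve_in_L:
  assumes "x + x \<in> L" shows "x \<in> L"
proof (rule L_I)
  show "x \<in> U" using assms L_D(1) halve_in_U by blast
  show "u \<odot> x = 0" if "u \<in> U" for u
    using L_D(2)[OF assms that] by - (rule double_zero, simp add: mul_add_left mul_commute[of u x])
qed

lemma VV_in_L: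
  assumes "v \<in> V" "w \<in> V" shows "v \<odot> w \<in> L"
proof -
  have sq: "x \<odot> x \<in> L" if "x \<in> V" for x
    using that cubic_relations(3) by (intro L_I VV_in_U) auto
  have "(v + w) \<odot> (v + w) - v \<odot> v - w \<odot> w \<in> L"
    using assms by (intro subspace_diff subspace_L sq subspace_add subspace_V)
  then have "v \<odot> w + v \<odot> w \<in> L" by (simp add: square_polarize)
  then show ?thesis by (rule halve_in_L)
qed

lemma VL_in_L:
  assumes "v \<in> V" "l \<in> L" shows "v \<odot> l \<in> L"
proof (rule L_I)
  have lU: "l \<in> U" using assms L_D by blast
  then show "v \<odot> l \<in> U" using UV_in_U assms by (metis mul_commute)
  fix u assume u: "u \<in> U"
  have "u \<odot> (l \<odot> v) = - (l \<odot> (u \<odot> v))" using u lU assms by (intro skew_UUV)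
  also have "l \<odot> (u \<odot> v) = 0" using L_D(2)[OF assms(2)] UV_in_U[OF u assms(1)] by blast
  finally show "u \<odot> (v \<odot> l) = 0" by (simp add: mul_commute)
qed

lemma NL_in_L: "n \<in> N \<Longrightarrow> l \<in> L \<Longrightarrow> n \<odot> l \<in> L"
proof -
  assume "n \<in> N" and l: "l \<in> L"
  then obtain u v where n: "n = u + v" "u \<in> U" "v \<in> V" by (elim N_decomposition)
  have "u \<odot> l = 0" using L_D(2)[OF l n(2)] by (simp add: mul_commute)
  then show ?thesis using VL_in_L[OF n(3) l] by (simp add: n mul_add_left)
qed

lemma weight_decomposition: "x - \<omega> x *s e \<in> N"
  using weight_add[of "x - \<omega> x *s e" "\<omega> x *s e"] by (simp add: barideal_def weight_scale weight_e)

lemma ideal_if_e_N_stable: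
  assumes J: "subspace J" and e: "\<And>x. x \<in> J \<Longrightarrow> e \<odot> x \<in> J"
    and N: "\<And>n x. n \<in> N \<Longrightarrow> x \<in> J \<Longrightarrow> n \<odot> x \<in> J"
  shows "ideal J"
proof -
  have "a \<odot> x \<in> J" if "x \<in> J" for a x
  proof -
    have "a \<odot> x = \<omega> a *s (e \<odot> x) + (a - \<omega> a *s e) \<odot> x"
      by (simp add: mul_diff_left mul_scale_left)
    then show ?thesis
      using e[OF that] N[OF weight_decomposition that] J by (simp add: subspace_add subspace_scale)
  qed
  then show ?thesis using J unfolding ideal_def by (metis mul_commute)
qed

lemma ideal_L: "ideal L"
proof (rule ideal_if_e_N_stable[OF subspace_L _ NL_in_L])
  fix x assume x: "x \<in> L"
  then have "x \<in> U" by (rule L_D(1))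
  then have "e \<odot> x = (1/2) *s x" unfolding peirce_U_def by (rule CollectD)
  then show "e \<odot> x \<in> L" using x by (simp add: subspace_scale subspace_L)
qed

text \<open>
  The component of \<open>((u + v) (u + v))\<^sup>2 = 0\<close> that is quadratic in both variables reads
  \<open>2 (u u) (v v) + 4 (u v) (u v) = 0\<close>.  Here \<open>(u u) (v v)\<close> lies in \<open>U\<close> and \<open>(u v) (u v)\<close> in \<open>V\<close>,
  so both terms vanish.
\<close>
lemma UV_square_zero:
  assumes u: "u \<in> U" and v: "v \<in> V"
  shows "(u \<odot> v) \<odot> (u \<odot> v) = 0"
proof -
  define A where "A = u \<odot> u + v \<odot> v"
  define B where "B = u \<odot> v + u \<odot> v"
  have plus: "(A + B) \<odot> (A + B) = 0"
    using bernstein_components(4)[OF U_V_in_N(3)[OF u v]]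
    by (simp add: square_polarize[of u v] A_def B_def algebra_simps)
  have "- v \<in> V" using v by (intro subspace_neg subspace_V)
  then have minus: "(A + - B) \<odot> (A + - B) = 0"
    using bernstein_components(4)[OF U_V_in_N(3)[OF u, of "- v"]]
    unfolding square_polarize[of u "- v"]
    by (simp add: A_def B_def mul_minus_left mul_minus_right algebra_simps)
  have "A \<odot> A + B \<odot> B + (A \<odot> A + B \<odot> B) = (A + B) \<odot> (A + B) + (A + - B) \<odot> (A + - B)"
    unfolding square_polarize by (simp add: mul_minus_left mul_minus_right)
  then have AB: "A \<odot> A + B \<odot> B = 0" using plus minus by - (rule double_zero, simp)
  define x where "x = (u \<odot> u) \<odot> (v \<odot> v)"
  have "(u \<odot> u) \<odot> (u \<odot> u) = 0" "(v \<odot> v) \<odot> (v \<odot> v) = 0"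
    using bernstein_components(4) U_V_in_N u v by auto
  then have AA: "A \<odot> A = x + x" by (simp add: A_def square_polarize x_def)
  have xU: "x + x \<in> U"
    unfolding x_def using UU_in_V[OF u u] VV_in_U[OF v v] UV_in_U
    by (auto intro!: subspace_add subspace_U simp: mul_commute[of "u \<odot> u"])
  have BV: "B \<odot> B \<in> V"
    unfolding B_def using u v by (intro UU_in_V subspace_add subspace_U UV_in_U)
  have "x + x = - (B \<odot> B)" using AB AA by (simp add: eq_neg_iff_add_eq_0)
  then have "x + x \<in> V" using BV by (simp add: subspace_neg subspace_V)
  then have "x + x = 0" using xU U_V_disjoint by blast
  then have "B \<odot> B = 0" using AB AA by simp
  then have "(u \<odot> v) \<odot> (u \<odot> v) + (u \<odot> v) \<odot> (u \<odot> v) + ((u \<odot> v) \<odot> (u \<odot> v) + (u \<odot> v) \<odot> (u \<odot> v)) = 0"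
    by (simp add: B_def mul_add_left mul_add_right)
  then show ?thesis using double_zero by blast
qed

text \<open>
  It suffices that \<open>x (x u)\<close> annihilates \<open>U\<close>, and \<open>u' (x (x u)) = - (x u) (x u')\<close> is a polarisation of
  \<open>UV_square_zero\<close>.
\<close>
lemma VVU_anticommute_mod_L:
  assumes v: "v \<in> V" and w: "w \<in> V" and u: "u \<in> U"
  shows "v \<odot> (w \<odot> u) + w \<odot> (v \<odot> u) \<in> L"
proof -
  have VU: "x \<odot> y \<in> U" if "x \<in> V" "y \<in> U" for x y
    using UV_in_U[OF that(2,1)] by (simp add: mul_commute)
  have sq: "x \<odot> (x \<odot> u) \<in> L" if x: "x \<in> V" for x
  proof (rule L_I)
    show "x \<odot> (x \<odot> u) \<in> U" using x u by (intro VU)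
    fix u' assume u': "u' \<in> U"
    have "((u + u') \<odot> x) \<odot> ((u + u') \<odot> x) = 0"
      using u u' x by (intro UV_square_zero subspace_add subspace_U)
    then have "(u \<odot> x) \<odot> (u' \<odot> x) + (u \<odot> x) \<odot> (u' \<odot> x) = 0"
      using UV_square_zero[OF u x] UV_square_zero[OF u' x]
      by (simp add: mul_add_left[of u u' x] square_polarize)
    then have z: "(u \<odot> x) \<odot> (u' \<odot> x) = 0" by (rule double_zero)
    have "u' \<odot> ((u \<odot> x) \<odot> x) = - ((u \<odot> x) \<odot> (u' \<odot> x))"
      using u u' x by (intro skew_UUV UV_in_U)
    then show "u' \<odot> (x \<odot> (x \<odot> u)) = 0" using z by (simp add: mul_commute[of x])
  qed
  have "(v + w) \<odot> ((v + w) \<odot> u) - v \<odot> (v \<odot> u) - w \<odot> (w \<odot> u) \<in> L"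
    using v w by (intro subspace_diff subspace_L sq subspace_add subspace_V)
  then show ?thesis by (simp add: mul_add_left mul_add_right algebra_simps)
qed

lemma e_N_square:
  assumes "x \<in> subspace_prod N N" shows "e \<odot> x \<in> subspace_prod N N"
  using assms unfolding subspace_prod_def[of N N]
proof (rule mul_span_right)
  fix y assume "y \<in> {x \<odot> y |x y. x \<in> N \<and> y \<in> N}"
  then obtain a b where y: "y = a \<odot> b" "a \<in> N" "b \<in> N" by auto
  obtain u v where a: "a = u + v" "u \<in> U" "v \<in> V" using y by (elim N_decomposition)
  obtain u' v' where b: "b = u' + v'" "u' \<in> U" "v' \<in> V" using y by (elim N_decomposition)
  have "e \<odot> (u \<odot> u') = 0" using UU_in_V a b by (simp add: V_iff[symmetric])
  then have "e \<odot> y = (1/2) *s (u \<odot> v' + u' \<odot> v + v \<odot> v')"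
    using UV_in_U[OF a(2) b(3)] UV_in_U[OF b(2) a(3)] VV_in_U[OF a(3) b(3)]
    by (simp add: y(1) a(1) b(1) mul_add_left mul_add_right mul_commute[of v u'] peirce_U_def
        scale_right_distrib algebra_simps)
  moreover have "u \<odot> v' + u' \<odot> v + v \<odot> v' \<in> subspace_prod N N"
    using a b U_V_in_N by (intro subspace_add subspace_subspace_prod subspace_prodI) auto
  ultimately show "e \<odot> y \<in> span {x \<odot> y |x y. x \<in> N \<and> y \<in> N}"
    unfolding subspace_prod_def[symmetric] by (simp add: subspace_scale)
qed simp

text \<open>
  Every subspace spanned by the square of \<open>N\<close> and homogeneous elements is an ideal of the whole algebra,
  so a chain condition on ideals bounds the dimension of \<open>N\<close> modulo its square.
\<close>
lemma N_finite_modulo_square: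
  assumes "noetherian \<or> artinian"
  shows "\<exists>F. finite F \<and> F \<subseteq> N \<and> N \<subseteq> span (F \<union> subspace_prod N N)"
proof -
  have "ideal (span (C \<union> subspace_prod N N))" if C: "C \<subseteq> U \<union> V" for C
  proof (rule ideal_if_e_N_stable)
    let ?J = "span (C \<union> subspace_prod N N)"
    have "?J \<subseteq> N"
    proof (rule span_minimal[OF _ subspace_N])
      have "subspace_prod N N \<subseteq> N"
        by (rule subspace_prod_subset[OF subspace_N]) (simp add: barideal_def weight_mult)
      then show "C \<union> subspace_prod N N \<subseteq> N" using C U_subset_N V_subset_N by blast
    qed
    then show "n \<odot> x \<in> ?J" if "n \<in> N" "x \<in> ?J" for n x
      using that by (intro span_base UnI2 subspace_prodI) auto
    show "e \<odot> x \<in> ?J" if "x \<in> ?J" for x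
      using that
    proof (rule mul_span_right)
      fix y assume "y \<in> C \<union> subspace_prod N N"
      then consider "y \<in> C" "y \<in> U" | "y \<in> V" | "y \<in> subspace_prod N N" using C by blast
      then show "e \<odot> y \<in> ?J"
      proof cases
        case 1
        then show ?thesis by (simp add: peirce_U_def span_scale span_base)
      next
        case 2
        then show ?thesis by (simp add: V_iff span_zero)
      next
        case 3
        then show ?thesis using e_N_square by (intro span_base) auto
      qed
    qed simp
  qed simp
  then obtain F where F: "finite F" "F \<subseteq> U \<union> V" "U \<union> V \<subseteq> span (F \<union> subspace_prod N N)"
    using finite_spanning_modulo[OF assms, of "U \<union> V" "subspace_prod N N"] by blast
  have "N \<subseteq> span (F \<union> subspace_prod N N)"
    using F(3) by (auto elim!: N_decomposition intro!: span_add)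
  then show ?thesis using F(1,2) U_subset_N V_subset_N by blast
qed

section \<open>Subspaces absorbed by the barideal\<close>

text \<open>
  The projection \<open>\<pi>\<close> along \<open>L\<close> turns \<open>\<pi> (x y)\<close> into a product that is graded mock-Lie on
  \<open>\<pi> U + \<pi> V\<close>, hence nilpotent there.  Since \<open>I\<close> is contained in \<open>N I\<close>, its image lies in all
  powers of this algebra and so is zero.
\<close>
lemma subset_L_if_absorbed:
  assumes chain: "noetherian \<or> artinian" and I: "I \<subseteq> subspace_prod N I" "I \<subseteq> N"
  shows "I \<subseteq> L"
proof -
  obtain \<pi> where \<pi>_add: "\<And>x y. \<pi> (x + y) = \<pi> x + \<pi> y" and \<pi>_scale: "\<And>c x. \<pi> (c *s x) = c *s \<pi> x"
    and \<pi>_diff: "\<And>x. \<pi> x - x \<in> L" and \<pi>_L: "\<And>x. x \<in> L \<Longrightarrow> \<pi> x = 0"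
    using subspace_projection_exists[OF subspace_L] by metis
  have \<pi>0: "\<pi> 0 = 0" using \<pi>_L subspace_0[OF subspace_L] by blast
  have \<pi>_minus: "\<pi> (- x) = - \<pi> x" for x using \<pi>_add[of x "- x"] \<pi>0 by (simp add: eq_neg_iff_add_eq_0 add.commute)
  define mulQ where "mulQ x y = \<pi> (x \<odot> y)" for x y
  have mulQ: "mulQ (\<pi> x) (\<pi> y) = \<pi> (x \<odot> y)" for x y
  proof -
    have "\<pi> x \<odot> \<pi> y = x \<odot> y + (\<pi> x - x) \<odot> y + \<pi> x \<odot> (\<pi> y - y)"
      by (simp add: mul_diff_left mul_diff_right)
    moreover have "\<pi> ((\<pi> x - x) \<odot> y) = 0" "\<pi> (\<pi> x \<odot> (\<pi> y - y)) = 0"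
      using ideal_L \<pi>_diff by (auto simp: ideal_def intro: \<pi>_L)
    ultimately show ?thesis by (simp add: mulQ_def \<pi>_add)
  qed
  have sub: "subspace (\<pi> ` X)" if "subspace X" for X
  proof (rule subspaceI)
    show "0 \<in> \<pi> ` X" using \<pi>0 subspace_0[OF that] by force
    show "x + y \<in> \<pi> ` X" if "x \<in> \<pi> ` X" "y \<in> \<pi> ` X" for x y
      using that \<pi>_add subspace_add[OF \<open>subspace X\<close>] by (auto simp: image_iff) metis
    show "c *s x \<in> \<pi> ` X" if "x \<in> \<pi> ` X" for c x
      using that \<pi>_scale subspace_scale[OF \<open>subspace X\<close>] by (auto simp: image_iff) metis
  qed
  have VU: "x \<odot> y \<in> U" if "x \<in> V" "y \<in> U" for x y
    using UV_in_U[OF that(2,1)] by (simp add: mul_commute)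
  interpret Q: graded_mock_lie scale mulQ "\<pi> ` U" "\<pi> ` V"
  proof unfold_locales
    show "mulQ (x + y) z = mulQ x z + mulQ y z" "mulQ x (y + z) = mulQ x y + mulQ x z"
      "mulQ (c *s x) y = c *s mulQ x y" "mulQ x (c *s y) = c *s mulQ x y" for x y z c
      by (simp_all add: mulQ_def mul_add_left mul_add_right mul_scale_left mul_scale_right \<pi>_add \<pi>_scale)
    show "subspace (\<pi> ` U)" "subspace (\<pi> ` V)" using subspace_U subspace_V by (auto intro: sub)
    show "(2::'k) \<noteq> 0" "(3::'k) \<noteq> 0" by (fact two_nonzero, fact three_nonzero)
    show "mulQ a b \<in> \<pi> ` V" if "a \<in> \<pi> ` U" "b \<in> \<pi> ` U" for a b
      using that UU_in_V by (auto simp: mulQ)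
    show "mulQ v a \<in> \<pi> ` U" if "v \<in> \<pi> ` V" "a \<in> \<pi> ` U" for v a
      using that VU by (auto simp: mulQ)
    show "mulQ v w = 0" if "v \<in> \<pi> ` V" "w \<in> \<pi> ` V" for v w
      using that VV_in_L by (auto simp: mulQ \<pi>_L)
    show "mulQ a b = mulQ b a" if "a \<in> \<pi> ` U" "b \<in> \<pi> ` U" for a b
      by (simp add: mulQ_def mul_commute)
    show "mulQ a v = mulQ v a" if "a \<in> \<pi> ` U" "v \<in> \<pi> ` V" for a v
      by (simp add: mulQ_def mul_commute)
    show "mulQ (mulQ a b) c + mulQ (mulQ b c) a + mulQ (mulQ c a) b = 0"
      if "a \<in> \<pi> ` U" "b \<in> \<pi> ` U" "c \<in> \<pi> ` U" for a b c
      using that by (auto simp: mulQ \<pi>_add[symmetric] cyclic_UUU \<pi>0)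
    show "mulQ (mulQ v a) b = - mulQ a (mulQ v b)"
      if mem: "v \<in> \<pi> ` V" "a \<in> \<pi> ` U" "b \<in> \<pi> ` U" for v a b
    proof -
      obtain v' a' b' where "v = \<pi> v'" "a = \<pi> a'" "b = \<pi> b'" "v' \<in> V" "a' \<in> U" "b' \<in> U"
        using mem by blast
      then show ?thesis
        using skew_UUV[of b' a' v'] by (simp add: mulQ \<pi>_minus[symmetric] mul_commute[of _ b'] mul_commute[of v'])
    qed
    show "mulQ v (mulQ w a) = - mulQ w (mulQ v a)"
      if "v \<in> \<pi> ` V" "w \<in> \<pi> ` V" "a \<in> \<pi> ` U" for v w a
      using that VVU_anticommute_mod_L by (auto simp: mulQ eq_neg_iff_add_eq_0 \<pi>_add[symmetric] \<pi>_L)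
  qed
  have QN: "Q.N = \<pi> ` N"
  proof
    show "Q.N \<subseteq> \<pi> ` N"
      using U_V_in_N(3) by (auto simp: Q.N_def \<pi>_add[symmetric])
    show "\<pi> ` N \<subseteq> Q.N"
    proof
      fix x assume "x \<in> \<pi> ` N"
      then obtain n where "x = \<pi> n" "n \<in> N" by blast
      then obtain u v where "x = \<pi> u + \<pi> v" "u \<in> U" "v \<in> V"
        using \<pi>_add by (metis N_decomposition)
      then show "x \<in> Q.N" unfolding Q.N_def by blast
    qed
  qed
  have sub_vimage: "subspace {x. \<pi> x \<in> Z}" if "subspace Z" for Z
    using that by (auto simp: subspace_def \<pi>0 \<pi>_add \<pi>_scale)
  have \<pi>_prod: "\<pi> x \<in> Q.subspace_prod (\<pi> ` X) (\<pi> ` Y)" if "x \<in> subspace_prod X Y" for x X Y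
  proof -
    have "subspace_prod X Y \<subseteq> {x. \<pi> x \<in> Q.subspace_prod (\<pi> ` X) (\<pi> ` Y)}"
    proof (rule subspace_prod_subset[OF sub_vimage])
      show "x \<odot> y \<in> {x. \<pi> x \<in> Q.subspace_prod (\<pi> ` X) (\<pi> ` Y)}" if "x \<in> X" "y \<in> Y" for x y
        using Q.subspace_prodI[of "\<pi> x" "\<pi> ` X" "\<pi> y" "\<pi> ` Y"] that by (simp add: mulQ)
    qed simp
    then show ?thesis using that by blast
  qed
  obtain F where F: "finite F" "F \<subseteq> N" "N \<subseteq> span (F \<union> subspace_prod N N)"
    using N_finite_modulo_square[OF chain] by blast
  have "Q.N \<subseteq> span (\<pi> ` F \<union> Q.subspace_prod Q.N Q.N)"
  proof -
    have "span (F \<union> subspace_prod N N) \<subseteq> {x. \<pi> x \<in> span (\<pi> ` F \<union> Q.subspace_prod Q.N Q.N)}"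
      using \<pi>_prod by (intro span_minimal sub_vimage subspace_span) (auto simp: QN intro!: span_base)
    then show ?thesis using F(3) by (auto simp: QN)
  qed
  moreover have "finite (\<pi> ` F)" "\<pi> ` F \<subseteq> Q.N" using F unfolding QN by blast+
  ultimately obtain n where n: "Q.N_power n Q.N \<subseteq> {0}"
    using Q.finitely_generated_nilpotent[of "\<pi> ` F"] by blast
  have "\<pi> ` I \<subseteq> Q.N_power k Q.N" for k
  proof (induction k)
    case 0
    then show ?case using I(2) by (auto simp: QN)
  next
    case (Suc k)
    have "\<pi> ` I \<subseteq> Q.subspace_prod (\<pi> ` N) (\<pi> ` I)" using I(1) \<pi>_prod by blast
    also have "\<dots> \<subseteq> Q.subspace_prod Q.N (Q.N_power k Q.N)"
      using Suc by (intro Q.subspace_prod_mono) (simp_all add: QN)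
    finally show ?case by simp
  qed
  then have "\<pi> x = 0" if "x \<in> I" for x using n that by blast
  then have "- x \<in> L" if "x \<in> I" for x using \<pi>_diff[of x] that by simp
  then show ?thesis using subspace_neg[OF subspace_L] by force
qed

theorem absorbed_subspaces:
  assumes chain: "noetherian \<or> artinian" and I: "subspace I"
  shows "(subspace_prod N I = I \<longrightarrow> I \<subseteq> L \<and> ideal I) \<and>
    (subspace_prod N I = I \<longleftrightarrow> subspace_prod V I = I)"
proof -
  have prod_N: "x \<odot> y \<in> N" if "x \<in> N" for x y
    using that by (simp add: barideal_def weight_mult)
  have "I \<subseteq> L" if "subspace_prod N I = I"
  proof (rule subset_L_if_absorbed[OF chain])
    have "subspace_prod N I \<subseteq> N" by (intro subspace_prod_subset subspace_N prod_N)
    then show "I \<subseteq> N" "I \<subseteq> subspace_prod N I" using that by auto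
  qed
  moreover have "I \<subseteq> L" if "subspace_prod V I = I"
  proof (rule subset_L_if_absorbed[OF chain])
    have "subspace_prod V I \<subseteq> subspace_prod N I"
      using V_subset_N by (intro subspace_prod_mono) auto
    moreover have "subspace_prod N I \<subseteq> N" by (intro subspace_prod_subset subspace_N prod_N)
    ultimately show "I \<subseteq> N" "I \<subseteq> subspace_prod N I" using that by auto
  qed
  moreover have "subspace_prod N I = subspace_prod V I" if "I \<subseteq> L"
  proof
    show "subspace_prod V I \<subseteq> subspace_prod N I"
      using V_subset_N by (intro subspace_prod_mono) auto
    show "subspace_prod N I \<subseteq> subspace_prod V I"
    proof (rule subspace_prod_subset)
      fix n i assume "n \<in> N" and i: "i \<in> I"
      then obtain u v where n: "n = u + v" "u \<in> U" "v \<in> V" by (elim N_decomposition)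
      have "u \<odot> i = 0" using L_D(2)[of i u] n i that by (auto simp: mul_commute)
      then show "n \<odot> i \<in> subspace_prod V I"
        using n i by (simp add: mul_add_left subspace_prodI)
    qed simp
  qed
  moreover have "ideal I" if "I \<subseteq> L" "subspace_prod N I = I"
  proof (rule ideal_if_e_N_stable[OF I])
    show "e \<odot> x \<in> I" if "x \<in> I" for x
      using that \<open>I \<subseteq> L\<close> L_D(1)[of x] subspace_scale[OF I] by (auto simp: peirce_U_def)
    show "n \<odot> x \<in> I" if "n \<in> N" "x \<in> I" for n x
      using that subspace_prodI[of n N x I] \<open>subspace_prod N I = I\<close> by simp
  qed
  ultimately show ?thesis by metis
qed

end

lemma two_three_nonzero:
  assumes "CHAR('k::field) \<noteq> 2" "CHAR('k) \<noteq> 3"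
  shows "(2::'k) \<noteq> 0" "(3::'k) \<noteq> 0"
proof -
  have "(of_nat p :: 'k) \<noteq> 0" if "prime p" "CHAR('k) \<noteq> p" for p :: nat
    using that CHAR_not_1[where 'a = 'k] by (auto simp: of_nat_eq_0_iff_char_dvd prime_nat_iff)
  from this[of 2] this[of 3] show "(2::'k) \<noteq> 0" "(3::'k) \<noteq> 0" using assms by auto
qed

theorem lemma5p1:
  fixes scale :: "'k::field \<Rightarrow> 'a::ab_group_add \<Rightarrow> 'a"
    and mul :: "'a \<Rightarrow> 'a \<Rightarrow> 'a"
    and \<omega> :: "'a \<Rightarrow> 'k"
    and e :: 'a
    and U V N I :: "'a set"
  assumes "infinite (UNIV :: 'k set)"
    and "CHAR('k) \<noteq> 2" and "CHAR('k) \<noteq> 3"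
    and "bernstein_algebra scale mul \<omega>"
    and "nonassoc_algebra.noetherian scale mul \<or> nonassoc_algebra.artinian scale mul"
    and "e \<noteq> 0" and "mul e e = e"
    and "U = nonassoc_algebra.peirce_U scale mul e"
    and "V = nonassoc_algebra.peirce_V mul e"
    and "N = baric_algebra.barideal \<omega>"
    and "module.subspace scale I"
  shows "(nonassoc_algebra.subspace_prod scale mul N I = I \<longrightarrow>
            I \<subseteq> nonassoc_algebra.annihilator mul U U \<and> nonassoc_algebra.ideal scale mul I) \<and>
         (nonassoc_algebra.subspace_prod scale mul N I = I \<longleftrightarrow>
            nonassoc_algebra.subspace_prod scale mul V I = I)"
proof -
  interpret bernstein_algebra scale mul \<omega> by fact
  interpret bernstein_peirce scale mul \<omega> e
    using assms(6,7) two_three_nonzero[OF assms(2,3)] by unfold_locales auto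
  show ?thesis
    unfolding assms(8-10) using assms(5,11) by (rule absorbed_subspaces)
qed

end
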